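(* Let $\mathcal{A}$ be a central and essential arrangement in $\mathbb{Q}^l$ as in the context, with $\lcm$-period $\rho_0$, let $\sigma$ be a term ordering and $p$ a prime. Then the following are equivalent: (1) $p$ is not good for $\mathcal{A}$ or $p$ is not $(\sigma,l)$-lucky for $\mathcal{A}$; (2) $p$ divides $\rho_0$.
   Context: $\mathcal{A}=\{H_1,\dots,H_n\}$: $n$ distinct linear hyperplanes in $\mathbb{Q}^l$ with $\bigcap H_i=\{0\}$, $H_i=\{\alpha_i=0\}$, $\alpha_i=\sum_{k=1}^lc_{ki}x_k$ with $c_{ki}\in\mathbb{Z}$ not all divisible by any prime. $p$ is good for $\mathcal{A}$ if the reduction mod $p$ of $\prod\alpha_i$ is reduced (no $(\alpha_i)_p$ is a scalar multiple of $(\alpha_j)_p$, $i<j$). Let $C=(c_{ki})\in\mathrm{Mat}_{l\times n}(\mathbb{Z})$ with columns $c_1,\dots,c_n$; for nonempty $J=\{i_1<\dots<i_k\}\subseteq[n]$, $C_J=(c_{i_1},\dots,c_{i_k})$, with Smith normal form having nonzero diagonal entries $e_{J,1}\mid\dots\mid e_{J,r}$ (positive), $r=\mathrm{rk}(C_J)$; $e(J)=e_{J,r}$ and $\rho_0=\lcm\{e(J): 1\le|J|\le l\}$. For a term ordering $\sigma$ and nonzero $f\in\mathbb{Z}[x_1,\dots,x_l]$, $\mathrm{LM}_\sigma(f)$ is the $\sigma$-leading term times its coefficient $\mathrm{LC}_\sigma(f)$. A minimal strong $\sigma$-Gröbner basis of an ideal $I\subseteq\mathbb{Z}[x_1,\dots,x_l]$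 is a finite generating set $G$ of nonzero elements of $I$ such that every nonzero $f\in I$ has $\mathrm{LM}_\sigma(f)$ divisible by some $\mathrm{LM}_\sigma(g)$, $g\in G$, and no $\mathrm{LM}_\sigma(g)$ divides $\mathrm{LM}_\sigma(g')$ for distinct $g,g'$; its set of leading coefficients is independent of the choice. $p$ is $\sigma$-lucky for $I$ if it divides none of them; $p$ is $(\sigma,l)$-lucky for $\mathcal{A}$ if it is $\sigma$-lucky for every ideal $\langle\alpha_{i_1},\dots,\alpha_{i_l}\rangle$ with $i_1<\dots<i_l$ and $\operatorname{codim}(H_{i_1}\cap\dots\cap H_{i_l})=l$. *)

theory Defs
  imports "HOL-Library.Poly_Mapping" "HOL-Computational_Algebra.Primes" "HOL-Number_Theory.Cong"
    "Jordan_Normal_Form.Matrix"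
begin

text \<open>Monomials in variables x_0, x_1, ... (index k stands for x_(k+1)) and
  integer multivariate polynomials.\<close>
type_synonym monom = "nat \<Rightarrow>\<^sub>0 nat"
type_synonym ipoly = "monom \<Rightarrow>\<^sub>0 int"

definition monoms_in :: "nat \<Rightarrow> monom set" where
  "monoms_in l = {m. Poly_Mapping.keys m \<subseteq> {..<l}}"

definition polys_in :: "nat \<Rightarrow> ipoly set" where
  "polys_in l = {f. Poly_Mapping.keys f \<subseteq> monoms_in l}"

definition gen_ideal :: "nat \<Rightarrow> ipoly set \<Rightarrow> ipoly set" where
  "gen_ideal l S = {(\<Sum>s\<in>F. h s * s) | F h. finite F \<and> F \<subseteq> S \<and> (\<forall>s\<in>F. h s \<in> polys_in l)}"

definition term_order :: "nat \<Rightarrow> (monom \<Rightarrow> monom \<Rightarrow> bool) \<Rightarrow> bool" where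
  "term_order l tord \<longleftrightarrow>
     (\<forall>a\<in>monoms_in l. tord a a) \<and>
     (\<forall>a\<in>monoms_in l. \<forall>b\<in>monoms_in l. tord a b \<and> tord b a \<longrightarrow> a = b) \<and>
     (\<forall>a\<in>monoms_in l. \<forall>b\<in>monoms_in l. \<forall>c\<in>monoms_in l. tord a b \<and> tord b c \<longrightarrow> tord a c) \<and>
     (\<forall>a\<in>monoms_in l. \<forall>b\<in>monoms_in l. tord a b \<or> tord b a) \<and>
     (\<forall>a\<in>monoms_in l. tord 0 a) \<and>
     (\<forall>a\<in>monoms_in l. \<forall>b\<in>monoms_in l. \<forall>c\<in>monoms_in l. tord a b \<longrightarrow> tord (a + c) (b + c))"

definition lt :: "(monom \<Rightarrow> monom \<Rightarrow> bool) \<Rightarrow> ipoly \<Rightarrow> monom" where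
  "lt tord f = (THE m. m \<in> Poly_Mapping.keys f \<and> (\<forall>m'\<in>Poly_Mapping.keys f. tord m' m))"

definition lc :: "(monom \<Rightarrow> monom \<Rightarrow> bool) \<Rightarrow> ipoly \<Rightarrow> int" where
  "lc tord f = Poly_Mapping.lookup f (lt tord f)"

definition LM :: "(monom \<Rightarrow> monom \<Rightarrow> bool) \<Rightarrow> ipoly \<Rightarrow> ipoly" where
  "LM tord f = Poly_Mapping.single (lt tord f) (lc tord f)"

definition min_strong_GB :: "nat \<Rightarrow> (monom \<Rightarrow> monom \<Rightarrow> bool) \<Rightarrow> ipoly set \<Rightarrow> ipoly set \<Rightarrow> bool" where
  "min_strong_GB l tord G I \<longleftrightarrow>
     finite G \<and> G \<subseteq> I - {0} \<and> gen_ideal l G = I \<and>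
     (\<forall>f\<in>I - {0}. \<exists>g\<in>G. LM tord g dvd LM tord f) \<and>
     (\<forall>g\<in>G. \<forall>g'\<in>G. g \<noteq> g' \<longrightarrow> \<not> LM tord g dvd LM tord g')"

definition lucky :: "nat \<Rightarrow> (monom \<Rightarrow> monom \<Rightarrow> bool) \<Rightarrow> int \<Rightarrow> ipoly set \<Rightarrow> bool" where
  "lucky l tord p I \<longleftrightarrow> (\<forall>G. min_strong_GB l tord G I \<longrightarrow> (\<forall>g\<in>G. \<not> p dvd lc tord g))"

text \<open>The arrangement: coefficient matrix c k i (k < l rows, i < n columns).\<close>
definition lin_form :: "nat \<Rightarrow> (nat \<Rightarrow> nat \<Rightarrow> int) \<Rightarrow> nat \<Rightarrow> ipoly" where
  "lin_form l c i = (\<Sum>k<l. Poly_Mapping.single (Poly_Mapping.single k 1) (c k i))"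

definition good_prime :: "nat \<Rightarrow> nat \<Rightarrow> (nat \<Rightarrow> nat \<Rightarrow> int) \<Rightarrow> int \<Rightarrow> bool" where
  "good_prime l n c p \<longleftrightarrow>
     (\<forall>i j. i < j \<and> j < n \<longrightarrow>
        \<not> (\<exists>a::int. \<forall>k<l. [c k i = a * c k j] (mod p)) \<and>
        \<not> (\<exists>a::int. \<forall>k<l. [c k j = a * c k i] (mod p)))"

definition meet_zero :: "nat \<Rightarrow> (nat \<Rightarrow> nat \<Rightarrow> int) \<Rightarrow> nat set \<Rightarrow> bool" where
  "meet_zero l c J \<longleftrightarrow>
     (\<forall>x::nat \<Rightarrow> rat. (\<forall>i\<in>J. (\<Sum>k<l. of_int (c k i) * x k) = 0) \<longrightarrow> (\<forall>k<l. x k = 0))"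

definition lucky_arr :: "nat \<Rightarrow> nat \<Rightarrow> (nat \<Rightarrow> nat \<Rightarrow> int) \<Rightarrow> (monom \<Rightarrow> monom \<Rightarrow> bool) \<Rightarrow> int \<Rightarrow> bool" where
  "lucky_arr l n c tord p \<longleftrightarrow>
     (\<forall>J. J \<subseteq> {..<n} \<and> card J = l \<and> meet_zero l c J \<longrightarrow>
        lucky l tord p (gen_ideal l (lin_form l c ` J)))"

definition sub_mat :: "nat \<Rightarrow> (nat \<Rightarrow> nat \<Rightarrow> int) \<Rightarrow> nat set \<Rightarrow> int mat" where
  "sub_mat l c J = mat l (card J) (\<lambda>(k, j). c k (sorted_list_of_set J ! j))"

definition smith_diag :: "int mat \<Rightarrow> nat \<Rightarrow> bool" where
  "smith_diag D r \<longleftrightarrow>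
     (\<forall>i<dim_row D. \<forall>j<dim_col D. i \<noteq> j \<longrightarrow> D $$ (i, j) = 0) \<and>
     r \<le> min (dim_row D) (dim_col D) \<and>
     (\<forall>i<r. D $$ (i, i) > 0) \<and>
     (\<forall>i. r \<le> i \<and> i < min (dim_row D) (dim_col D) \<longrightarrow> D $$ (i, i) = 0) \<and>
     (\<forall>i. i + 1 < r \<longrightarrow> D $$ (i, i) dvd D $$ (i + 1, i + 1))"

definition e_last :: "nat \<Rightarrow> (nat \<Rightarrow> nat \<Rightarrow> int) \<Rightarrow> nat set \<Rightarrow> int" where
  "e_last l c J = (SOME e. \<exists>U V D r.
      U \<in> carrier_mat l l \<and> V \<in> carrier_mat (card J) (card J) \<and>
      invertible_mat U \<and> invertible_mat V \<and>
      U * sub_mat l c J * V = D \<and> smith_diag D r \<and> 0 < r \<and> e = D $$ (r - 1, r - 1))"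

definition rho0 :: "nat \<Rightarrow> nat \<Rightarrow> (nat \<Rightarrow> nat \<Rightarrow> int) \<Rightarrow> int" where
  "rho0 l n c = Lcm (e_last l c ` {J. J \<subseteq> {..<n} \<and> J \<noteq> {} \<and> card J \<le> l})"

end

theory Submission
  imports Defs "Jordan_Normal_Form.Column_Operations"
begin

text \<open>Write \<open>C\<^sub>J\<close> for the matrix of the columns in \<open>J\<close> and \<open>I\<^sub>J\<close> for the ideal of their linear forms.
  If \<open>J\<close> is a basis then \<open>e(J) x\<^sub>k \<in> I\<^sub>J\<close> for every variable, and combining a Groebner basis element with a
  multiple of \<open>e(J) x\<^sub>k\<close> having the same leading monomial shows that all leading coefficients divide
  \<open>e(J)\<close>. Conversely, if \<open>p\<close> divides \<open>e(J)\<close>, a row \<open>w\<close> of the transformation matrix gives a linear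
  functional, nonzero mod \<open>p\<close>, which annihilates the linear parts of \<open>I\<^sub>J\<close> mod \<open>p\<close>. Taking the
  \<open>\<sigma>\<close>-smallest variable \<open>x\<^sub>k\<close> with \<open>w\<^sub>k\<close> nonzero mod \<open>p\<close>, the basis element whose leading monomial
  divides \<open>e(J) x\<^sub>k\<close> must have leading coefficient divisible by \<open>p\<close>. So \<open>p\<close> is lucky for \<open>I\<^sub>J\<close> iff it does
  not divide \<open>e(J)\<close>. Every \<open>J\<close> is dominated by a basis \<open>B\<close> in the sense that \<open>e(J)\<close> divides \<open>e(B)\<close>,
  and two columns proportional mod \<open>p\<close> but not over the rationals force \<open>p\<close> to divide \<open>e(J)\<close>
  for that pair \<open>J\<close>.\<close>

section \<open>Ideals and strong Groebner bases over the integers\<close>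

lemma lookup_single_times_add:
  "Poly_Mapping.lookup (Poly_Mapping.single t b * f) (t + m) = b * Poly_Mapping.lookup f m"
  for t m :: monom and f :: ipoly
  by (simp add: lookup_mult lookup_single when_mult)

lemma lookup_single_times_eq_0:
  fixes t s :: monom and f :: ipoly
  assumes "\<And>u. s \<noteq> t + u"
  shows "Poly_Mapping.lookup (Poly_Mapping.single t b * f) s = 0"
  using assms by (simp add: lookup_mult lookup_single when_mult)

lemma keys_single_times:
  "Poly_Mapping.keys (Poly_Mapping.single t b * f) \<subseteq> (+) t ` Poly_Mapping.keys f"
  for t :: monom and f :: ipoly
  using keys_mult[of "Poly_Mapping.single t b" f] by (auto split: if_splits)

lemma ipoly_eq_sum_single:
  "f = (\<Sum>t\<in>Poly_Mapping.keys f. Poly_Mapping.single t (Poly_Mapping.lookup f t))"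
  for f :: ipoly
  by (rule poly_mapping_eqI)
    (simp add: lookup_sum lookup_single when_def sum.delta not_in_keys_iff_lookup_eq_zero)

text \<open>Comparing coefficients at \<open>m'\<close> in
  \<open>single m' a' = single m a * q\<close> yields both conditions. With \<open>a' = 0\<close>
  the second polynomial would be zero and no relation between the monomials could be read
  off.\<close>

lemma single_dvd_single_iff:
  fixes m m' :: monom and a a' :: int
  assumes "a' \<noteq> 0"
  shows "(Poly_Mapping.single m a :: ipoly) dvd Poly_Mapping.single m' a' \<longleftrightarrow> (\<exists>t. m' = m + t) \<and> a dvd a'"
proof
  assume "(Poly_Mapping.single m a :: ipoly) dvd Poly_Mapping.single m' a'"
  then obtain q where q: "Poly_Mapping.single m' a' = Poly_Mapping.single m a * (q :: ipoly)" by (auto elim: dvdE)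
  then have e: "a' = Poly_Mapping.lookup (Poly_Mapping.single m a * q) m'"
    by (metis lookup_single_eq)
  then obtain t where t: "m' = m + t" using lookup_single_times_eq_0[of m' m a q] assms by auto
  with e have "a' = a * Poly_Mapping.lookup q t" by (simp add: lookup_single_times_add)
  then show "(\<exists>t. m' = m + t) \<and> a dvd a'" using t by auto
next
  assume "(\<exists>t. m' = m + t) \<and> a dvd a'"
  then obtain t b where "m' = m + t" "a' = a * b" unfolding dvd_def by blast
  then have "Poly_Mapping.single m' a' = Poly_Mapping.single m a * (Poly_Mapping.single t b :: ipoly)"
    by (simp add: mult_single)
  then show "(Poly_Mapping.single m a :: ipoly) dvd Poly_Mapping.single m' a'" by simp
qed

section \<open>Polynomials in the first \<open>l\<close> variables and their ideals\<close>

lemma monoms_in_0 [simp]: "0 \<in> monoms_in l"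
  by (simp add: monoms_in_def)

lemma monoms_in_add_iff: "a + b \<in> monoms_in l \<longleftrightarrow> a \<in> monoms_in l \<and> b \<in> monoms_in l"
  by (auto simp: monoms_in_def subset_iff in_keys_iff lookup_add)

lemma monoms_in_var: "k < l \<Longrightarrow> Poly_Mapping.single k e \<in> monoms_in l"
  by (auto simp: monoms_in_def)

lemma polys_in_single: "m \<in> monoms_in l \<Longrightarrow> Poly_Mapping.single m a \<in> polys_in l"
  by (auto simp: polys_in_def)

lemma polys_in_0 [simp]: "0 \<in> polys_in l"
  by (simp add: polys_in_def)

lemma polys_in_add: "f \<in> polys_in l \<Longrightarrow> g \<in> polys_in l \<Longrightarrow> f + g \<in> polys_in l"
  using keys_add[of f g] by (auto simp: polys_in_def)

lemma polys_in_times: "f \<in> polys_in l \<Longrightarrow> g \<in> polys_in l \<Longrightarrow> f * g \<in> polys_in l"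
  using keys_mult[of f g] by (fastforce simp: polys_in_def monoms_in_add_iff)

text \<open>Only the multipliers are confined to \<open>l\<close> variables, not the members. Sets
  cut out by a condition on coefficients thus qualify without being intersected with
  \<open>polys_in l\<close>.\<close>

definition is_ideal :: "nat \<Rightarrow> ipoly set \<Rightarrow> bool" where
  "is_ideal l I \<longleftrightarrow> 0 \<in> I \<and> (\<forall>f\<in>I. \<forall>g\<in>I. f + g \<in> I) \<and> (\<forall>h\<in>polys_in l. \<forall>f\<in>I. h * f \<in> I)"

lemma is_ideal_0: "is_ideal l I \<Longrightarrow> 0 \<in> I"
  and is_ideal_add: "is_ideal l I \<Longrightarrow> f \<in> I \<Longrightarrow> g \<in> I \<Longrightarrow> f + g \<in> I"
  and is_ideal_times: "is_ideal l I \<Longrightarrow> h \<in> polys_in l \<Longrightarrow> f \<in> I \<Longrightarrow> h * f \<in> I"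
  by (auto simp: is_ideal_def)

lemma is_ideal_sum: "is_ideal l I \<Longrightarrow> (\<And>x. x \<in> A \<Longrightarrow> f x \<in> I) \<Longrightarrow> sum f A \<in> I"
  by (induction A rule: infinite_finite_induct) (auto intro: is_ideal_0 is_ideal_add)

text \<open>Every multiplier is the finite sum of its terms, so closure under addition reduces
  absorption to multipliers consisting of one term.\<close>

lemma is_idealI:
  assumes "0 \<in> I" "\<And>f g. f \<in> I \<Longrightarrow> g \<in> I \<Longrightarrow> f + g \<in> I"
    and single: "\<And>t b f. t \<in> monoms_in l \<Longrightarrow> f \<in> I \<Longrightarrow> Poly_Mapping.single t b * f \<in> I"
  shows "is_ideal l I"
  unfolding is_ideal_def
proof (intro conjI ballI)
  fix h f assume h: "h \<in> polys_in l" and f: "f \<in> I"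
  have sum: "sum g A \<in> I" if "\<And>x. x \<in> A \<Longrightarrow> g x \<in> I" for g and A :: "monom set"
    using that by (induction A rule: infinite_finite_induct) (auto intro: assms)
  have "h * f = (\<Sum>t\<in>Poly_Mapping.keys h. Poly_Mapping.single t (Poly_Mapping.lookup h t) * f)"
    by (subst ipoly_eq_sum_single[of h]) (simp add: sum_distrib_right)
  also have "\<dots> \<in> I"
    using h f by (intro sum single) (auto simp: polys_in_def)
  finally show "h * f \<in> I" .
qed (use assms in auto)

lemma is_ideal_gen_ideal: "is_ideal l (gen_ideal l S)"
  unfolding is_ideal_def
proof (intro conjI ballI)
  show "0 \<in> gen_ideal l S"
    unfolding gen_ideal_def by (rule CollectI, rule exI[of _ "{}"]) auto
next
  fix f g assume "f \<in> gen_ideal l S" "g \<in> gen_ideal l S"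
  then obtain F h F' h' where
    F: "finite F" "F \<subseteq> S" "\<forall>s\<in>F. h s \<in> polys_in l" "f = (\<Sum>s\<in>F. h s * s)" and
    F': "finite F'" "F' \<subseteq> S" "\<forall>s\<in>F'. h' s \<in> polys_in l" "g = (\<Sum>s\<in>F'. h' s * s)"
    unfolding gen_ideal_def by blast
  \<comment> \<open>Multipliers missing from one of the two representations are padded with zero, so
    that both sums run over \<open>F \<union> F'\<close>.\<close>
  define k where "k s = (if s \<in> F then h s else 0) + (if s \<in> F' then h' s else 0)" for s
  have "f = (\<Sum>s\<in>F \<union> F'. (if s \<in> F then h s else 0) * s)"
    unfolding F by (rule sum.mono_neutral_cong_left) (use F F' in auto)
  moreover have "g = (\<Sum>s\<in>F \<union> F'. (if s \<in> F' then h' s else 0) * s)"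
    unfolding F' by (rule sum.mono_neutral_cong_left) (use F F' in auto)
  ultimately have "f + g = (\<Sum>s\<in>F \<union> F'. k s * s)"
    by (simp add: k_def sum.distrib distrib_right)
  moreover have "\<forall>s\<in>F \<union> F'. k s \<in> polys_in l"
    using F(3) F'(3) by (auto simp: k_def intro: polys_in_add)
  ultimately show "f + g \<in> gen_ideal l S"
    unfolding gen_ideal_def using F(1,2) F'(1,2)
    by (intro CollectI exI[of _ "F \<union> F'"] exI[of _ k]) auto
next
  fix h f assume h: "h \<in> polys_in l" and "f \<in> gen_ideal l S"
  then obtain F k where "finite F" "F \<subseteq> S" "\<forall>s\<in>F. k s \<in> polys_in l" "f = (\<Sum>s\<in>F. k s * s)"
    unfolding gen_ideal_def by blast
  then show "h * f \<in> gen_ideal l S"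
    unfolding gen_ideal_def using h
    by (intro CollectI exI[of _ F] exI[of _ "\<lambda>s. h * k s"])
      (auto simp: sum_distrib_left mult.assoc intro: polys_in_times)
qed

lemma gen_ideal_superset: "S \<subseteq> gen_ideal l S"
proof
  fix s assume "s \<in> S"
  have "1 \<in> polys_in l" by (simp add: polys_in_def)
  with \<open>s \<in> S\<close> show "s \<in> gen_ideal l S"
    unfolding gen_ideal_def by (intro CollectI exI[of _ "{s}"] exI[of _ "\<lambda>_. 1"]) auto
qed

lemma gen_ideal_least: "is_ideal l I \<Longrightarrow> S \<subseteq> I \<Longrightarrow> gen_ideal l S \<subseteq> I"
  unfolding gen_ideal_def by (auto intro!: is_ideal_sum is_ideal_times)

lemma is_ideal_polys_in: "is_ideal l (polys_in l)"
  by (auto simp: is_ideal_def intro: polys_in_add polys_in_times)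

section \<open>Dickson's lemma\<close>

text \<open>Every sequence has a monotone subsequence. A decreasing sequence of naturals is constant
  once it attains its least value, so a tail of it is weakly increasing as well.\<close>

lemma nat_seq_incseq_subseq:
  fixes s :: "nat \<Rightarrow> nat"
  shows "\<exists>\<phi>. strict_mono \<phi> \<and> incseq (s \<circ> \<phi>)"
proof -
  obtain f where f: "strict_mono f" "monoseq (\<lambda>n. s (f n))" using seq_monosub[of s] by blast
  show ?thesis
  proof (cases "incseq (\<lambda>n. s (f n))")
    case True
    then show ?thesis using f(1) by (auto simp: comp_def)
  next
    case False
    with f(2) have d: "decseq (\<lambda>n. s (f n))" by (auto simp: monoseq_iff)
    define v where "v = (LEAST v. \<exists>n. s (f n) = v)"
    have "\<exists>n. s (f n) = v" unfolding v_def by (rule LeastI_ex) auto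
    then obtain N where N: "s (f N) = v" by blast
    have "s (f (N + n)) = v" for n
    proof (rule antisym)
      show "s (f (N + n)) \<le> v" using d N by (metis decseqD le_add1)
      show "v \<le> s (f (N + n))" unfolding v_def by (rule Least_le) auto
    qed
    then have "incseq (s \<circ> (\<lambda>n. f (N + n)))" by (simp add: incseq_def)
    moreover have "strict_mono (\<lambda>n. f (N + n))" using f(1) by (simp add: strict_mono_def)
    ultimately show ?thesis by blast
  qed
qed

text \<open>Subsequences are extracted one coordinate after another; monotonicity gained in earlier
  coordinates survives each further extraction.\<close>

lemma dickson_coordinates:
  fixes s :: "nat \<Rightarrow> nat \<Rightarrow> nat"
  shows "\<exists>\<phi>. strict_mono \<phi> \<and> (\<forall>k<l. incseq (\<lambda>i. s (\<phi> i) k))"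
proof (induction l)
  case 0
  show ?case by (rule exI[of _ id]) (auto simp: strict_mono_def)
next
  case (Suc l)
  then obtain \<phi> where \<phi>: "strict_mono \<phi>" "\<forall>k<l. incseq (\<lambda>i. s (\<phi> i) k)" by blast
  obtain \<psi> where \<psi>: "strict_mono \<psi>" "incseq ((\<lambda>i. s (\<phi> i) l) \<circ> \<psi>)"
    using nat_seq_incseq_subseq by blast
  have "incseq (\<lambda>i. s ((\<phi> \<circ> \<psi>) i) k)" if "k < Suc l" for k
  proof (cases "k = l")
    case False
    then have "incseq (\<lambda>i. s (\<phi> i) k)" using that \<phi> by simp
    then show ?thesis using \<psi>(1)
      by (auto simp: incseq_def strict_mono_less_eq)
  qed (use \<psi> in \<open>simp add: comp_def\<close>)
  then show ?case using \<phi>(1) \<psi>(1) by (intro exI[of _ "\<phi> \<circ> \<psi>"]) (auto simp: strict_mono_def)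
qed

lemma dickson:
  fixes s :: "nat \<Rightarrow> monom"
  assumes "\<And>i. s i \<in> monoms_in l"
  obtains \<phi> :: "nat \<Rightarrow> nat" where "strict_mono \<phi>" "\<And>i j. i \<le> j \<Longrightarrow> \<exists>t\<in>monoms_in l. s (\<phi> j) = s (\<phi> i) + t"
proof -
  obtain \<phi> where \<phi>: "strict_mono \<phi>" "\<forall>k<l. incseq (\<lambda>i. Poly_Mapping.lookup (s (\<phi> i)) k)"
    using dickson_coordinates[of l "\<lambda>i. Poly_Mapping.lookup (s i)"] by blast
  \<comment> \<open>Subtraction of exponents is truncated at zero, so it is the monotonicity of each
    coordinate that makes the difference a cofactor. From index \<open>l\<close> on all exponents
    vanish.\<close>
  have "s (\<phi> j) = s (\<phi> i) + (s (\<phi> j) - s (\<phi> i))" if "i \<le> j" for i j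
  proof (rule poly_mapping_eqI)
    fix k
    show "Poly_Mapping.lookup (s (\<phi> j)) k = Poly_Mapping.lookup (s (\<phi> i) + (s (\<phi> j) - s (\<phi> i))) k"
    proof (cases "k < l")
      case True
      then have "Poly_Mapping.lookup (s (\<phi> i)) k \<le> Poly_Mapping.lookup (s (\<phi> j)) k"
        using \<phi>(2) that by (simp add: incseq_def)
      then show ?thesis by (simp add: lookup_add lookup_minus)
    next
      case False
      then have "Poly_Mapping.lookup (s n) k = 0" for n
        using assms[of n] by (auto simp: monoms_in_def in_keys_iff)
      then show ?thesis by (simp add: lookup_add lookup_minus)
    qed
  qed
  then show ?thesis using \<phi>(1) assms monoms_in_add_iff that by metis
qed

section \<open>Existence of minimal strong Groebner bases\<close>

locale monomial_order =
  fixes l :: nat and tord :: "monom \<Rightarrow> monom \<Rightarrow> bool"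
  assumes order: "term_order l tord"
begin

lemma tord_refl: "a \<in> monoms_in l \<Longrightarrow> tord a a"
  using order by (auto simp: term_order_def)

lemma tord_antisym: "a \<in> monoms_in l \<Longrightarrow> b \<in> monoms_in l \<Longrightarrow> tord a b \<Longrightarrow> tord b a \<Longrightarrow> a = b"
  using order unfolding term_order_def by blast

lemma tord_trans:
  "a \<in> monoms_in l \<Longrightarrow> b \<in> monoms_in l \<Longrightarrow> c \<in> monoms_in l \<Longrightarrow> tord a b \<Longrightarrow> tord b c \<Longrightarrow> tord a c"
  using order unfolding term_order_def by blast

lemma tord_total: "a \<in> monoms_in l \<Longrightarrow> b \<in> monoms_in l \<Longrightarrow> tord a b \<or> tord b a"
  using order unfolding term_order_def by blast

lemma tord_add_mono:
  "a \<in> monoms_in l \<Longrightarrow> b \<in> monoms_in l \<Longrightarrow> c \<in> monoms_in l \<Longrightarrow> tord a b \<Longrightarrow> tord (a + c) (b + c)"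
  using order unfolding term_order_def by blast

lemma tord_add_self:
  assumes "a \<in> monoms_in l" "c \<in> monoms_in l"
  shows "tord a (c + a)"
proof -
  have "tord 0 c" using order assms unfolding term_order_def by blast
  from tord_add_mono[OF _ assms(2,1) this] show ?thesis by simp
qed

lemma finite_tord_maximum:
  assumes "finite A" "A \<noteq> {}" "A \<subseteq> monoms_in l"
  shows "\<exists>m\<in>A. \<forall>m'\<in>A. tord m' m"
  using assms
proof (induction A rule: finite_ne_induct)
  case (singleton x)
  then show ?case by (simp add: tord_refl)
next
  case (insert x F)
  then obtain m where m: "m \<in> F" "\<forall>m'\<in>F. tord m' m" by auto
  then show ?case using tord_total[of x m] tord_trans[of _ m x] tord_refl[of x] insert.prems by blast
qed

text \<open>In an infinite strict descent Dickson's lemma finds an earlier monomial that divides a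
  later one. A divisor lies below its multiple in a term ordering, which contradicts the
  descent.\<close>

lemma wf_tord: "wf {(a, b). a \<in> monoms_in l \<and> b \<in> monoms_in l \<and> tord a b \<and> a \<noteq> b}" (is "wf ?R")
  unfolding wf_iff_no_infinite_down_chain
proof
  assume "\<exists>s. \<forall>i. (s (Suc i), s i) \<in> ?R"
  then obtain s where s: "s i \<in> monoms_in l" "tord (s (Suc i)) (s i)" "s (Suc i) \<noteq> s i" for i
    by auto
  have desc: "tord (s (i + j)) (s i)" for i j
    by (induction j) (auto intro: tord_refl s tord_trans[OF s(1) s(1) s(1)])
  obtain \<phi> :: "nat \<Rightarrow> nat" where \<phi>: "strict_mono \<phi>"
      "\<And>i j. i \<le> j \<Longrightarrow> \<exists>t\<in>monoms_in l. s (\<phi> j) = s (\<phi> i) + t"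
    using dickson[of s l] s(1) by metis
  define i where "i = \<phi> 0"
  have "i < \<phi> (Suc 0)" using \<phi>(1) by (simp add: i_def strict_mono_less)
  \<comment> \<open>The later index is at least \<open>Suc i\<close>, so the strict step from
    \<open>s i\<close> to \<open>s (Suc i)\<close> lies on the way to it.\<close>
  then obtain j where j: "\<phi> (Suc 0) = Suc i + j" by (metis add_Suc less_imp_Suc_add)
  obtain t where t: "t \<in> monoms_in l" "s (\<phi> (Suc 0)) = t + s i"
    using \<phi>(2)[of 0 "Suc 0"] by (auto simp: i_def add.commute)
  have "tord (s i) (s (\<phi> (Suc 0)))" using tord_add_self t s(1) by metis
  moreover have "tord (s (\<phi> (Suc 0))) (s (Suc i))" using desc[of "Suc i" j] j by metis
  ultimately have "tord (s i) (s (Suc i))" using tord_trans s(1) by metis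
  then show False using s tord_antisym by metis
qed

lemma lt_eqI:
  assumes "f \<in> polys_in l" "Poly_Mapping.lookup f m \<noteq> 0"
    and max: "\<And>m'. m' \<in> Poly_Mapping.keys f \<Longrightarrow> tord m' m"
  shows "lt tord f = m"
  unfolding lt_def
proof (rule the_equality)
  show "m \<in> Poly_Mapping.keys f \<and> (\<forall>m'\<in>Poly_Mapping.keys f. tord m' m)"
    using assms by (simp add: in_keys_iff)
next
  fix m' assume m': "m' \<in> Poly_Mapping.keys f \<and> (\<forall>n\<in>Poly_Mapping.keys f. tord n m')"
  have "m \<in> Poly_Mapping.keys f" using assms by (simp add: in_keys_iff)
  with m' show "m' = m" using assms(1) max tord_antisym unfolding polys_in_def by blast
qed

lemma lt_maximum:
  assumes "f \<in> polys_in l" "f \<noteq> 0"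
  shows lt_in_keys: "lt tord f \<in> Poly_Mapping.keys f"
    and lt_in_monoms: "lt tord f \<in> monoms_in l"
    and lc_neq_0: "lc tord f \<noteq> 0"
    and tord_lt: "m \<in> Poly_Mapping.keys f \<Longrightarrow> tord m (lt tord f)"
proof -
  have "Poly_Mapping.keys f \<noteq> {}"
    using assms(2) by (auto simp: poly_mapping_eq_iff fun_eq_iff in_keys_iff)
  then obtain m0 where m0: "m0 \<in> Poly_Mapping.keys f" "\<forall>m'\<in>Poly_Mapping.keys f. tord m' m0"
    using finite_tord_maximum[of "Poly_Mapping.keys f"] assms(1) by (auto simp: polys_in_def)
  then have [simp]: "lt tord f = m0" using lt_eqI[OF assms(1), of m0] by (simp add: in_keys_iff)
  show "lt tord f \<in> Poly_Mapping.keys f" "lt tord f \<in> monoms_in l" "lc tord f \<noteq> 0"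
    "m \<in> Poly_Mapping.keys f \<Longrightarrow> tord m (lt tord f)"
    using m0 assms(1) by (auto simp: lc_def in_keys_iff polys_in_def)
qed

lemma single_times_leading:
  assumes f: "f \<in> polys_in l" "f \<noteq> 0" and t: "t \<in> monoms_in l" and b: "b \<noteq> 0"
  shows single_times_neq_0: "Poly_Mapping.single t b * f \<noteq> 0"
    and lt_single_times: "lt tord (Poly_Mapping.single t b * f) = t + lt tord f"
    and lc_single_times: "lc tord (Poly_Mapping.single t b * f) = b * lc tord f"
proof -
  have l: "Poly_Mapping.lookup (Poly_Mapping.single t b * f) (t + lt tord f) = b * lc tord f"
    by (simp add: lookup_single_times_add lc_def)
  then have nz: "Poly_Mapping.lookup (Poly_Mapping.single t b * f) (t + lt tord f) \<noteq> 0"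
    using lc_neq_0[OF f] b by simp
  then show "Poly_Mapping.single t b * f \<noteq> 0" by auto
  show lt: "lt tord (Poly_Mapping.single t b * f) = t + lt tord f"
  proof (rule lt_eqI[OF _ nz])
    show "Poly_Mapping.single t b * f \<in> polys_in l"
      by (intro polys_in_times polys_in_single t f)
    fix m assume "m \<in> Poly_Mapping.keys (Poly_Mapping.single t b * f)"
    then obtain u where u: "u \<in> Poly_Mapping.keys f" "m = t + u" using keys_single_times by blast
    then have "u \<in> monoms_in l" using f by (auto simp: polys_in_def)
    then show "tord m (t + lt tord f)"
      using tord_add_mono[OF _ lt_in_monoms[OF f] t tord_lt[OF f u(1)]] u by (simp add: add.commute)
  qed
  show "lc tord (Poly_Mapping.single t b * f) = b * lc tord f"
    using l by (simp add: lc_def lt)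
qed

lemma LM_dvd_LM_iff:
  assumes "f \<in> polys_in l" "f \<noteq> 0"
  shows "LM tord g dvd LM tord f \<longleftrightarrow> (\<exists>t. lt tord f = lt tord g + t) \<and> lc tord g dvd lc tord f"
  unfolding LM_def by (rule single_dvd_single_iff[OF lc_neq_0[OF assms]])

text \<open>Bezout coefficients \<open>u\<close>, \<open>v\<close> give \<open>h\<close> as
  \<open>u\<close> times the shift of \<open>f\<close> by \<open>t\<close> plus \<open>v\<close>
  times \<open>g\<close>. Both summands have all their monomials at or below
  \<open>lt tord g\<close>, where their coefficients add up to the gcd; it is nonzero because
  \<open>lc tord f\<close> is.\<close>

lemma ideal_leading_gcd:
  assumes I: "is_ideal l I" "I \<subseteq> polys_in l"
    and f: "f \<in> I" "f \<noteq> 0" and g: "g \<in> I" "g \<noteq> 0"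
    and t: "lt tord g = t + lt tord f"
  shows "\<exists>h\<in>I - {0}. lt tord h = lt tord g \<and> lc tord h = gcd (lc tord f) (lc tord g)"
proof -
  note fP = subsetD[OF I(2) f(1)] and gP = subsetD[OF I(2) g(1)]
  have tm: "t \<in> monoms_in l"
    using lt_in_monoms[OF gP g(2)] by (simp add: t monoms_in_add_iff)
  obtain u v where uv: "u * lc tord f + v * lc tord g = gcd (lc tord f) (lc tord g)"
    using bezout_int by blast
  define h where "h = Poly_Mapping.single t u * f + Poly_Mapping.single 0 v * g"
  have hI: "h \<in> I"
    unfolding h_def by (intro is_ideal_add[OF I(1)] is_ideal_times[OF I(1)] polys_in_single tm f g monoms_in_0)
  have "Poly_Mapping.lookup (Poly_Mapping.single 0 v * g) (0 + lt tord g) = v * lc tord g"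
    unfolding lookup_single_times_add by (simp add: lc_def)
  then have lk: "Poly_Mapping.lookup h (lt tord g) = gcd (lc tord f) (lc tord g)"
    by (simp add: h_def lookup_add uv[symmetric] lookup_single_times_add t) (simp add: lc_def)
  then have nz: "Poly_Mapping.lookup h (lt tord g) \<noteq> 0"
    using lc_neq_0[OF fP f(2)] by simp
  have "lt tord h = lt tord g"
  proof (rule lt_eqI[OF _ nz])
    show "h \<in> polys_in l" using hI I by auto
    fix m assume "m \<in> Poly_Mapping.keys h"
    then have "m \<in> (+) t ` Poly_Mapping.keys f \<or> m \<in> Poly_Mapping.keys g"
      unfolding h_def using keys_add keys_single_times[of t u f] keys_single_times[of 0 v g] by fastforce
    then show "tord m (lt tord g)"
    proof
      assume "m \<in> (+) t ` Poly_Mapping.keys f"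
      then obtain w where w: "w \<in> Poly_Mapping.keys f" "m = t + w" by blast
      then have "w \<in> monoms_in l" using fP by (auto simp: polys_in_def)
      then show ?thesis
        using tord_add_mono[OF _ lt_in_monoms[OF fP f(2)] tm tord_lt[OF fP f(2) w(1)]] w t
        by (simp add: add.commute)
    qed (rule tord_lt[OF gP g(2)])
  qed
  then show ?thesis using hI nz lk by (intro bexI[of _ h]) (auto simp: lc_def)
qed

text \<open>Division with remainder: well-founded induction on the leading monomial, cancelling the
  leading term of \<open>f\<close> by a multiple of one element of \<open>G\<close> at a
  time.\<close>

lemma strong_generating_set:
  assumes I: "is_ideal l I" "I \<subseteq> polys_in l"
    and G: "G \<subseteq> I - {0}" and strong: "\<forall>f\<in>I - {0}. \<exists>g\<in>G. LM tord g dvd LM tord f"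
  shows "gen_ideal l G = I"
proof
  show "gen_ideal l G \<subseteq> I" using G by (intro gen_ideal_least I) auto
  have "f \<in> gen_ideal l G" if "f \<in> I" for f
  proof (cases "f = 0")
    case True
    then show ?thesis using is_ideal_0[OF is_ideal_gen_ideal] by simp
  next
    case False
    then show ?thesis using that
    proof (induction "lt tord f" arbitrary: f rule: wf_induct_rule[OF wf_tord])
      case (1 f)
      note f = 1(3,2) and fP = subsetD[OF I(2) 1(3)]
      obtain g where g: "g \<in> G" "LM tord g dvd LM tord f" using strong f by blast
      then have gI: "g \<in> I" "g \<noteq> 0" using G by auto
      note gP = subsetD[OF I(2) gI(1)]
      obtain t where t: "lt tord f = t + lt tord g"
        using g(2) unfolding LM_dvd_LM_iff[OF fP f(2)] by (auto simp: add.commute)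
      obtain b where b: "lc tord f = b * lc tord g"
        using g(2) unfolding LM_dvd_LM_iff[OF fP f(2)] by (metis dvd_div_mult_self)
      have tm: "t \<in> monoms_in l"
        using lt_in_monoms[OF fP f(2)] by (simp add: t monoms_in_add_iff)
      \<comment> \<open>This multiple of \<open>g\<close> has the same leading monomial and
        coefficient as \<open>f\<close>, so \<open>f - q\<close> is either zero or has a strictly
        smaller leading monomial.\<close>
      define q where "q = Poly_Mapping.single t b * g"
      have qP: "q \<in> polys_in l" unfolding q_def by (intro polys_in_times polys_in_single tm gP)
      have b0: "b \<noteq> 0" using lc_neq_0[OF fP f(2)] b by auto
      have q: "q \<noteq> 0" "lt tord q = lt tord f" "lc tord q = lc tord f"
        unfolding q_def using single_times_leading[OF gP gI(2) tm b0] t b by auto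
      have q_gen: "q \<in> gen_ideal l G"
        unfolding q_def using gen_ideal_superset g(1)
        by (intro is_ideal_times[OF is_ideal_gen_ideal] polys_in_single tm) auto
      have "f - q \<in> I"
      proof -
        have "f + Poly_Mapping.single t (- b) * g \<in> I"
          by (intro is_ideal_add[OF I(1)] is_ideal_times[OF I(1)] polys_in_single tm f gI)
        then show ?thesis by (simp add: q_def single_uminus)
      qed
      moreover have "f - q \<in> gen_ideal l G"
      proof (cases "f - q = 0")
        case True
        then show ?thesis using is_ideal_0[OF is_ideal_gen_ideal] by simp
      next
        case False
        have rP: "f - q \<in> polys_in l" using \<open>f - q \<in> I\<close> I by auto
        have ltk: "lt tord (f - q) \<in> Poly_Mapping.keys (f - q)" by (rule lt_in_keys[OF rP False])
        then have "lt tord (f - q) \<in> Poly_Mapping.keys f \<union> Poly_Mapping.keys q"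
          by (auto simp: in_keys_iff lookup_minus)
        then have "tord (lt tord (f - q)) (lt tord f)"
          using tord_lt[OF fP f(2)] tord_lt[OF qP q(1)] q(2) by auto
        moreover have "Poly_Mapping.lookup (f - q) (lt tord f) = 0"
          using q by (simp add: lookup_minus lc_def)
        then have "lt tord (f - q) \<noteq> lt tord f" using ltk by (auto simp: in_keys_iff)
        ultimately show ?thesis
          using 1(1)[of "f - q"] False \<open>f - q \<in> I\<close> lt_in_monoms[OF rP False] lt_in_monoms[OF fP f(2)]
          by simp
      qed
      ultimately show ?case using is_ideal_add[OF is_ideal_gen_ideal, of "f - q" l G q] q_gen by simp
    qed
  qed
  then show "I \<subseteq> gen_ideal l G" by blast
qed

text \<open>Existence matters because \<open>lucky\<close> quantifies over all minimal strong bases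
  and would hold vacuously if there were none. The basis takes one representative for each
  divisibility-minimal pair of leading monomial and leading coefficient.\<close>

lemma ex_min_strong_GB:
  assumes I: "is_ideal l I" "I \<subseteq> polys_in l"
  shows "\<exists>G. min_strong_GB l tord G I"
proof -
  define le :: "monom \<times> int \<Rightarrow> monom \<times> int \<Rightarrow> bool"
    where "le = (\<lambda>(m, a) (m', a'). (\<exists>t. m' = m + t) \<and> a dvd a')"
  \<comment> \<open>Absolute values remove the sign ambiguity of divisibility, so that
    \<open>le\<close> is antisymmetric on \<open>P\<close> and minimality in \<open>M\<close> can be
    stated as equality.\<close>
  define lead where "lead f = (lt tord f, \<bar>lc tord f\<bar>)" for f
  define P where "P = lead ` (I - {0})"
  define M where "M = {x \<in> P. \<forall>y\<in>P. le y x \<longrightarrow> y = x}"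
  have le_refl: "le x x" for x by (auto simp: le_def intro: exI[of _ 0])
  have le_trans: "le x z" if "le x y" "le y z" for x y z
    using that by (fastforce simp: le_def add.assoc intro: dvd_trans)
  have LM_le: "LM tord g dvd LM tord f \<longleftrightarrow> le (lead g) (lead f)" if "f \<in> I - {0}" for f g
    using that I LM_dvd_LM_iff[of f g] by (auto simp: lead_def le_def)
  have pos: "snd x > 0" if x: "x \<in> P" for x
  proof -
    obtain f where "f \<in> I" "f \<noteq> 0" "x = lead f" using x by (auto simp: P_def)
    then show ?thesis using lc_neq_0[OF subsetD[OF I(2)], of f] by (simp add: lead_def)
  qed
  have monoms: "fst x \<in> monoms_in l" if x: "x \<in> P" for x
  proof -
    obtain f where "f \<in> I" "f \<noteq> 0" "x = lead f" using x by (auto simp: P_def)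
    then show ?thesis using lt_in_monoms[OF subsetD[OF I(2)], of f] by (simp add: lead_def)
  qed
  have gcd_P: "(fst y, gcd (snd x) (snd y)) \<in> P"
    if xy: "x \<in> P" "y \<in> P" "fst y = t + fst x" for x y t
  proof -
    obtain f g where fg: "f \<in> I" "f \<noteq> 0" "g \<in> I" "g \<noteq> 0" "x = lead f" "y = lead g"
      using xy by (auto simp: P_def)
    have "lt tord g = t + lt tord f" using xy(3) fg by (simp add: lead_def)
    then obtain h where "h \<in> I - {0}" "lt tord h = lt tord g" "lc tord h = gcd (lc tord f) (lc tord g)"
      using ideal_leading_gcd[OF I fg(1-4)] by blast
    then show ?thesis unfolding P_def using fg by (intro image_eqI[of _ _ h]) (auto simp: lead_def)
  qed
  have M_below: "\<exists>y\<in>M. le y x" if "x \<in> P" for x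
  proof -
    define deg :: "monom \<Rightarrow> nat" where "deg m = (\<Sum>k<l. Poly_Mapping.lookup m k)" for m
    \<comment> \<open>Degree plus coefficient drops strictly whenever a pair is replaced by a proper
      divisor, so the search for a minimal divisor terminates.\<close>
    define size where "size x = deg (fst x) + nat (snd x)" for x
    have deg_add: "deg (a + b) = deg a + deg b" for a b
      by (simp add: deg_def lookup_add sum.distrib)
    have deg_0: "b = 0" if "deg b = 0" "b \<in> monoms_in l" for b
    proof (rule poly_mapping_eqI)
      fix k show "Poly_Mapping.lookup b k = Poly_Mapping.lookup 0 k"
        using that by (cases "k < l") (auto simp: deg_def monoms_in_def in_keys_iff)
    qed
    show ?thesis using that
    proof (induction "size x" arbitrary: x rule: less_induct)
      case (less x)
      show ?case
      proof (cases "x \<in> M")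
        case True
        then show ?thesis using le_refl by blast
      next
        case False
        then obtain y where y: "y \<in> P" "le y x" "y \<noteq> x" using less.prems by (auto simp: M_def)
        then obtain t where t: "fst x = fst y + t" "snd y dvd snd x" by (auto simp: le_def split: prod.splits)
        have tm: "t \<in> monoms_in l" using monoms[OF less.prems] t by (simp add: monoms_in_add_iff)
        have "snd y \<le> snd x" using t pos[OF less.prems] zdvd_imp_le by blast
        then have "deg (fst y) \<le> deg (fst x)" "nat (snd y) \<le> nat (snd x)"
          by (auto simp: t deg_add)
        moreover have "deg (fst y) \<noteq> deg (fst x) \<or> nat (snd y) \<noteq> nat (snd x)"
        proof (rule ccontr)
          assume "\<not> ?thesis"
          then have "t = 0" "snd y = snd x" using deg_0[OF _ tm] pos[OF y(1)] by (auto simp: t deg_add)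
          then show False using y(3) t(1) by (simp add: prod_eq_iff)
        qed
        ultimately have "size y < size x" by (auto simp: size_def)
        then obtain z where "z \<in> M" "le z y" using less.hyps y(1) by blast
        then show ?thesis using le_trans y(2) by blast
      qed
    qed
  qed
  \<comment> \<open>The gcd of the two coefficients occurs at the larger monomial. Minimality of
    \<open>y\<close> makes this gcd equal to \<open>snd y\<close>, so \<open>snd y\<close> divides
    \<open>snd x\<close>; equality is excluded because \<open>x\<close> would then lie below
    \<open>y\<close>.\<close>
  have M_desc: "snd y < snd x" if xy: "x \<in> M" "y \<in> M" "x \<noteq> y" "fst y = fst x + t" for x y t
  proof -
    have P: "x \<in> P" "y \<in> P" using xy by (auto simp: M_def)
    have "(fst y, gcd (snd x) (snd y)) \<in> P" using gcd_P[OF P, of t] xy by (simp add: add.commute)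
    moreover have "le (fst y, gcd (snd x) (snd y)) y"
      by (cases y) (auto simp: le_def intro: exI[of _ 0])
    ultimately have "(fst y, gcd (snd x) (snd y)) = y" using xy(2) unfolding M_def by blast
    then have "gcd (snd x) (snd y) = snd y" by (metis snd_conv)
    then have "snd y dvd snd x" by (metis gcd_dvd1)
    moreover have "snd y \<noteq> snd x"
    proof
      assume "snd y = snd x"
      then have "le x y" using xy(4) by (auto simp: le_def split: prod.splits)
      then show False using xy P by (auto simp: M_def)
    qed
    ultimately show ?thesis using zdvd_imp_le[of "snd y" "snd x"] pos[OF P(1)] by simp
  qed
  have "finite M"
  proof (rule ccontr)
    assume "infinite M"
    then obtain s :: "nat \<Rightarrow> monom \<times> int" where s: "inj s" "range s \<subseteq> M"
      using infinite_countable_subset by blast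
    have sM: "s i \<in> M" "s i \<in> P" for i using s by (auto simp: M_def)
    obtain \<phi> :: "nat \<Rightarrow> nat" where \<phi>: "strict_mono \<phi>"
        "\<And>i j. i \<le> j \<Longrightarrow> \<exists>t\<in>monoms_in l. fst (s (\<phi> j)) = fst (s (\<phi> i)) + t"
      using dickson[of "fst \<circ> s" l] monoms sM by (metis comp_apply)
    \<comment> \<open>Along the subsequence from Dickson's lemma each monomial divides the next, so
      \<open>M_desc\<close> produces an infinite strict descent of positive coefficients.\<close>
    have "nat (snd (s (\<phi> (Suc i)))) < nat (snd (s (\<phi> i)))" for i
    proof -
      have "s (\<phi> i) \<noteq> s (\<phi> (Suc i))" using s(1) \<phi>(1) by (auto simp: inj_eq strict_mono_eq)
      then show ?thesis using \<phi>(2)[of i "Suc i"] M_desc[OF sM(1) sM(1)] pos[OF sM(2)] by fastforce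
    qed
    then show False using wf_less wf_iff_no_infinite_down_chain[of "{(x :: nat, y). x < y}"]
      by (auto dest: spec[of _ "\<lambda>i. nat (snd (s (\<phi> i)))"])
  qed
  define rep where "rep x = (SOME f. f \<in> I - {0} \<and> lead f = x)" for x
  have rep: "rep x \<in> I - {0}" "lead (rep x) = x" if "x \<in> M" for x
  proof -
    have "\<exists>f. f \<in> I - {0} \<and> lead f = x" using that by (auto simp: M_def P_def)
    from someI_ex[OF this] show "rep x \<in> I - {0}" "lead (rep x) = x" unfolding rep_def by auto
  qed
  define G where "G = rep ` M"
  have GI: "G \<subseteq> I - {0}" using rep by (auto simp: G_def)
  have strong: "\<forall>f\<in>I - {0}. \<exists>g\<in>G. LM tord g dvd LM tord f"
  proof
    fix f assume f: "f \<in> I - {0}"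
    then obtain y where "y \<in> M" "le y (lead f)" using M_below[of "lead f"] by (auto simp: P_def)
    then show "\<exists>g\<in>G. LM tord g dvd LM tord f"
      using rep LM_le[OF f] by (auto simp: G_def)
  qed
  have "min_strong_GB l tord G I"
    unfolding min_strong_GB_def
  proof (intro conjI ballI impI)
    show "finite G" using \<open>finite M\<close> by (simp add: G_def)
    show "gen_ideal l G = I" by (rule strong_generating_set[OF I GI strong])
    fix g g' assume gg': "g \<in> G" "g' \<in> G" "g \<noteq> g'"
    then obtain x x' where "x \<in> M" "x' \<in> M" "g = rep x" "g' = rep x'" "x \<noteq> x'" by (auto simp: G_def)
    then show "\<not> LM tord g dvd LM tord g'"
      using rep LM_le[of g' g] by (auto simp: M_def)
  qed (use GI strong in auto)
  then show ?thesis by blast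
qed

end

section \<open>Ideals of linear forms\<close>

lemma monom_add_eq_0D:
  fixes t u :: monom
  assumes "t + u = 0"
  shows "t = 0" "u = 0"
proof -
  have "Poly_Mapping.lookup t k + Poly_Mapping.lookup u k = 0" for k
    using assms by (metis lookup_add lookup_zero)
  then show "t = 0" "u = 0" by (auto intro: poly_mapping_eqI)
qed

lemma monom_eq_single_plus:
  fixes m :: monom
  assumes "Poly_Mapping.lookup m k > 0"
  shows "\<exists>t. m = Poly_Mapping.single k 1 + t"
  using assms
  by (intro exI[of _ "m - Poly_Mapping.single k 1"] poly_mapping_eqI)
    (auto simp: lookup_add lookup_minus lookup_single when_def)

lemma var_eq_addD:
  fixes t u :: monom
  assumes e: "Poly_Mapping.single k 1 = t + u"
  shows "t = 0 \<or> u = 0"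
proof -
  have s: "Poly_Mapping.lookup t k + Poly_Mapping.lookup u k = 1"
    using e by (metis lookup_add lookup_single_eq)
  show ?thesis
  proof (cases "Poly_Mapping.lookup t k = 0")
    case True
    with s have "\<exists>v. u = Poly_Mapping.single k 1 + v" by (intro monom_eq_single_plus) simp
    then obtain v where "u = Poly_Mapping.single k 1 + v" by blast
    then have "Poly_Mapping.single k 1 + (t + v) = Poly_Mapping.single k 1 + 0"
      using e by (simp add: add.left_commute)
    then have "t + v = 0" by (rule add_left_imp_eq)
    then show ?thesis using monom_add_eq_0D by blast
  next
    case False
    then have "\<exists>v. t = Poly_Mapping.single k 1 + v" by (intro monom_eq_single_plus) simp
    then obtain v where "t = Poly_Mapping.single k 1 + v" by blast
    then have "Poly_Mapping.single k 1 + (v + u) = Poly_Mapping.single k 1 + 0"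
      using e by (simp add: add.assoc)
    then have "v + u = 0" by (rule add_left_imp_eq)
    then show ?thesis using monom_add_eq_0D by blast
  qed
qed

lemma lookup_single_times_0:
  "Poly_Mapping.lookup (Poly_Mapping.single t b * f) 0 = (if t = 0 then b * Poly_Mapping.lookup f 0 else 0)"
  for t :: monom and f :: ipoly
  using lookup_single_times_add[of 0 b f 0] lookup_single_times_eq_0[of 0 t b f] monom_add_eq_0D(1)
  by (metis add.right_neutral)

text \<open>A variable factors only as itself times the monomial one. Since \<open>f\<close> has no
  constant term, a nonconstant \<open>t\<close> cannot contribute to a linear coefficient.\<close>

lemma lookup_single_times_var:
  fixes t :: monom and f :: ipoly
  assumes "Poly_Mapping.lookup f 0 = 0"
  shows "Poly_Mapping.lookup (Poly_Mapping.single t b * f) (Poly_Mapping.single k 1)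
    = (if t = 0 then b * Poly_Mapping.lookup f (Poly_Mapping.single k 1) else 0)"
proof (cases "t = 0")
  case True
  then show ?thesis using lookup_single_times_add[of 0 b f "Poly_Mapping.single k 1"] by simp
next
  case False
  show ?thesis
  proof (cases "\<exists>u. Poly_Mapping.single k 1 = t + u")
    case True
    then obtain u where u: "Poly_Mapping.single k 1 = t + u" by blast
    then have "u = 0" using False var_eq_addD by blast
    then show ?thesis using u lookup_single_times_add[of t b f 0] False assms by simp
  qed (use lookup_single_times_eq_0[of "Poly_Mapping.single k 1" t b f] False in auto)
qed

lemma lookup_lin_form:
  "Poly_Mapping.lookup (lin_form l c i) m = (\<Sum>k<l. c k i when Poly_Mapping.single k 1 = m)"
  by (simp add: lin_form_def lookup_sum lookup_single)

lemma lookup_lin_form_0: "Poly_Mapping.lookup (lin_form l c i) 0 = 0"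
proof -
  have "Poly_Mapping.single k 1 \<noteq> (0 :: monom)" for k
    by (metis lookup_single_eq lookup_zero zero_neq_one)
  then show ?thesis by (simp add: lookup_lin_form)
qed

lemma single_var_eq_iff: "Poly_Mapping.single k 1 = (Poly_Mapping.single j 1 :: monom) \<longleftrightarrow> k = j"
  by (metis lookup_single_eq lookup_single_not_eq zero_neq_one)

lemma lookup_lin_form_var: "k < l \<Longrightarrow> Poly_Mapping.lookup (lin_form l c i) (Poly_Mapping.single k 1) = c k i"
  by (simp only: lookup_lin_form single_var_eq_iff) (simp add: when_def)

lemma lin_form_in_polys: "lin_form l c i \<in> polys_in l"
  unfolding lin_form_def
  by (rule is_ideal_sum[OF is_ideal_polys_in]) (auto intro: polys_in_single monoms_in_var)

text \<open>For \<open>f\<close> without constant term, the linear part of a multiple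
  \<open>h * f\<close> is the constant term of \<open>h\<close> times the linear part of
  \<open>f\<close>. A linear congruence on the linear part is therefore preserved by
  multiplication.\<close>

lemma is_ideal_linear_part:
  "is_ideal l {f :: ipoly. Poly_Mapping.lookup f 0 = 0 \<and>
     p dvd (\<Sum>k<l. w k * Poly_Mapping.lookup f (Poly_Mapping.single k 1))}" for p :: int
proof (rule is_idealI; (elim CollectE conjE)?; (intro CollectI conjI)?)
  fix t :: monom and b and f :: ipoly
  assume f: "Poly_Mapping.lookup f 0 = 0"
    "p dvd (\<Sum>k<l. w k * Poly_Mapping.lookup f (Poly_Mapping.single k 1))"
  then show "p dvd (\<Sum>k<l. w k * Poly_Mapping.lookup (Poly_Mapping.single t b * f) (Poly_Mapping.single k 1))"
    by (cases "t = 0")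
      (simp_all add: lookup_single_times_var[OF f(1), unfolded One_nat_def] mult.left_commute[of _ b]
        flip: sum_distrib_left)
qed (auto simp: lookup_add lookup_single_times_0 distrib_left sum.distrib)

lemma gen_lin_forms:
  fixes l :: nat and c :: "nat \<Rightarrow> nat \<Rightarrow> int" and J :: "nat set"
  defines "I \<equiv> gen_ideal l (lin_form l c ` J)"
  shows gen_lin_forms_in_polys: "I \<subseteq> polys_in l"
    and lookup_gen_lin_forms_0: "f \<in> I \<Longrightarrow> Poly_Mapping.lookup f 0 = 0"
    and dvd_gen_lin_forms: "f \<in> I \<Longrightarrow> \<forall>i\<in>J. p dvd (\<Sum>k<l. w k * c k i) \<Longrightarrow>
      p dvd (\<Sum>k<l. w k * Poly_Mapping.lookup f (Poly_Mapping.single k 1))"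
    and var_in_gen_lin_forms: "finite J \<Longrightarrow> k < l \<Longrightarrow>
      \<forall>k'<l. (\<Sum>i\<in>J. c k' i * z i) = (if k = k' then e else 0) \<Longrightarrow>
      Poly_Mapping.single (Poly_Mapping.single k 1) e \<in> I"
proof -
  show "I \<subseteq> polys_in l"
    unfolding I_def by (rule gen_ideal_least[OF is_ideal_polys_in]) (auto intro: lin_form_in_polys)
  have *: "I \<subseteq> {f. Poly_Mapping.lookup f 0 = 0 \<and>
     p dvd (\<Sum>k<l. w k * Poly_Mapping.lookup f (Poly_Mapping.single k 1))}"
    if "\<forall>i\<in>J. p dvd (\<Sum>k<l. w k * c k i)" for w :: "nat \<Rightarrow> int" and p
    unfolding I_def
    by (rule gen_ideal_least[OF is_ideal_linear_part])
      (use that in \<open>auto simp: lookup_lin_form_0 lookup_lin_form_var[unfolded One_nat_def]\<close>)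
  \<comment> \<open>Zero weights and modulus zero make the congruence trivial and leave only the
    statement on constant terms.\<close>
  show "f \<in> I \<Longrightarrow> Poly_Mapping.lookup f 0 = 0" using *[of 0 "\<lambda>_. 0"] by auto
  show "f \<in> I \<Longrightarrow> \<forall>i\<in>J. p dvd (\<Sum>k<l. w k * c k i) \<Longrightarrow>
      p dvd (\<Sum>k<l. w k * Poly_Mapping.lookup f (Poly_Mapping.single k 1))"
    using *[of p w] by blast
  assume J: "finite J" "k < l" and z: "\<forall>k'<l. (\<Sum>i\<in>J. c k' i * z i) = (if k = k' then e else 0)"
  have sum_single: "(\<Sum>i\<in>A. Poly_Mapping.single m (f i)) = Poly_Mapping.single m (\<Sum>i\<in>A. f i)"
    for A :: "nat set" and m :: monom and f :: "nat \<Rightarrow> int"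
    by (induction A rule: infinite_finite_induct) (auto simp: single_add)
  \<comment> \<open>The combination of the forms with constant multipliers \<open>z i\<close> is
    regrouped by variables; by the choice of \<open>z\<close> only the variable of index
    \<open>k\<close> keeps a coefficient, namely \<open>e\<close>.\<close>
  have "(\<Sum>i\<in>J. Poly_Mapping.single 0 (z i) * lin_form l c i)
    = (\<Sum>k'<l. \<Sum>i\<in>J. Poly_Mapping.single (Poly_Mapping.single k' 1) (c k' i * z i))"
    unfolding lin_form_def sum_distrib_left by (subst sum.swap) (simp add: mult_single mult.commute)
  also have "\<dots> = (\<Sum>k'<l. if k' = k then Poly_Mapping.single (Poly_Mapping.single k' 1) e else 0)"
    by (rule sum.cong) (use z in \<open>auto simp: sum_single\<close>)
  also have "\<dots> = Poly_Mapping.single (Poly_Mapping.single k 1) e"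
    using J(2) by simp
  finally have "Poly_Mapping.single (Poly_Mapping.single k 1) e
    = (\<Sum>i\<in>J. Poly_Mapping.single 0 (z i) * lin_form l c i)" ..
  also have "\<dots> \<in> I"
    unfolding I_def using gen_ideal_superset[of "lin_form l c ` J" l]
    by (intro is_ideal_sum[OF is_ideal_gen_ideal] is_ideal_times[OF is_ideal_gen_ideal] polys_in_single)
      auto
  finally show "Poly_Mapping.single (Poly_Mapping.single k 1) e \<in> I" .
qed

section \<open>Leading coefficients for ideals containing a common multiple of all variables\<close>

context monomial_order
begin

lemma lt_single: "m \<in> monoms_in l \<Longrightarrow> a \<noteq> 0 \<Longrightarrow> lt tord (Poly_Mapping.single m a) = m"
  by (rule lt_eqI) (auto intro: polys_in_single tord_refl split: if_splits)

lemma lc_single: "m \<in> monoms_in l \<Longrightarrow> a \<noteq> 0 \<Longrightarrow> lc tord (Poly_Mapping.single m a) = a"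
  by (simp add: lc_def lt_single)

text \<open>Some variable divides \<open>lt tord g\<close>, so \<open>e\<close> times this monomial
  lies in \<open>I\<close>, and hence \<open>gcd e (lc tord g)\<close> is a leading coefficient at
  the same monomial. The element \<open>g'\<close> of \<open>G\<close> responsible for it also has
  leading monomial dividing that of \<open>g\<close>; minimality forces
  \<open>g' = g\<close>.\<close>

lemma lc_min_strong_GB_dvd:
  assumes I: "is_ideal l I" "I \<subseteq> polys_in l"
    and no_const: "\<And>f. f \<in> I \<Longrightarrow> Poly_Mapping.lookup f 0 = 0"
    and vars: "\<And>k. k < l \<Longrightarrow> Poly_Mapping.single (Poly_Mapping.single k 1) e \<in> I"
    and G: "min_strong_GB l tord G I" "g \<in> G"
  shows "lc tord g dvd e"
proof (cases "e = 0")
  case False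
  have g: "g \<in> I" "g \<noteq> 0" using G by (auto simp: min_strong_GB_def)
  note gP = subsetD[OF I(2) g(1)]
  have "lt tord g \<noteq> 0" using lc_neq_0[OF gP g(2)] no_const[OF g(1)] by (auto simp: lc_def)
  then obtain k where k: "Poly_Mapping.lookup (lt tord g) k > 0"
    by (metis gr0I lookup_zero poly_mapping_eqI)
  then obtain t where t: "lt tord g = Poly_Mapping.single k 1 + t" using monom_eq_single_plus by blast
  have kl: "k < l" "t \<in> monoms_in l"
    using lt_in_monoms[OF gP g(2)] by (auto simp: t monoms_in_add_iff) (auto simp: monoms_in_def)
  define f :: ipoly where "f = Poly_Mapping.single (lt tord g) e"
  have "f = Poly_Mapping.single t 1 * Poly_Mapping.single (Poly_Mapping.single k 1) e"
    by (simp add: f_def t mult_single add.commute)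
  then have fI: "f \<in> I" using is_ideal_times[OF I(1) polys_in_single[OF kl(2)] vars[OF kl(1)]] by simp
  have f0: "f \<noteq> 0" by (metis False f_def lookup_single_eq lookup_zero)
  have ltf: "lt tord f = lt tord g" "lc tord f = e"
    unfolding f_def using lt_in_monoms[OF gP g(2)] False by (auto simp: lt_single lc_single)
  obtain h where h: "h \<in> I" "h \<noteq> 0" "lt tord h = lt tord g" "lc tord h = gcd e (lc tord g)"
    using ideal_leading_gcd[OF I fI f0 g, of 0] ltf by auto
  then obtain g' where g': "g' \<in> G" "LM tord g' dvd LM tord h"
    using G unfolding min_strong_GB_def by blast
  then have d: "\<exists>t. lt tord g = lt tord g' + t" "lc tord g' dvd gcd e (lc tord g)"
    using LM_dvd_LM_iff[OF subsetD[OF I(2) h(1)] h(2)] h by auto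
  then have "LM tord g' dvd LM tord g"
    using LM_dvd_LM_iff[OF gP g(2)] by auto
  then have "g' = g" using G g'(1) by (auto simp: min_strong_GB_def)
  then show ?thesis using d(2) by simp
qed simp

lemma not_lucky_if_linear_relation:
  fixes p :: int
  assumes I: "is_ideal l I" "I \<subseteq> polys_in l" and p: "prime p" and e: "e \<noteq> 0"
    and no_const: "\<And>f. f \<in> I \<Longrightarrow> Poly_Mapping.lookup f 0 = 0"
    and vars: "\<And>k. k < l \<Longrightarrow> Poly_Mapping.single (Poly_Mapping.single k 1) e \<in> I"
    and w: "k0 < l" "\<not> p dvd w k0"
    and rel: "\<And>f. f \<in> I \<Longrightarrow> p dvd (\<Sum>k<l. w k * Poly_Mapping.lookup f (Poly_Mapping.single k 1))"
  shows "\<not> lucky l tord p I"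
proof -
  obtain G where G: "min_strong_GB l tord G I" using ex_min_strong_GB[OF I] by blast
  define x :: "nat \<Rightarrow> monom" where "x k = Poly_Mapping.single k 1" for k
  have xm: "x k \<in> monoms_in l" if "k < l" for k using that by (simp add: x_def monoms_in_def)
  define K where "K = {k. k < l \<and> \<not> p dvd w k}"
  have "x k0 \<in> x ` K" using w by (auto simp: K_def)
  \<comment> \<open>Well-foundedness of the ordering supplies the smallest variable whose weight is
    nonzero mod \<open>p\<close>.\<close>
  then obtain m where m: "m \<in> x ` K"
      "\<And>y. (y, m) \<in> {(a, b). a \<in> monoms_in l \<and> b \<in> monoms_in l \<and> tord a b \<and> a \<noteq> b} \<Longrightarrow> y \<notin> x ` K"
    by (rule wfE_min[OF wf_tord]) blast
  then obtain k where k: "k < l" "\<not> p dvd w k" and mk: "m = x k"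
    by (auto simp: K_def)
  have min: "tord (x k) (x j)" if "j < l" "\<not> p dvd w j" for j
  proof (cases "x j = x k")
    case True
    then show ?thesis using tord_refl[OF xm[OF k(1)]] by simp
  next
    case False
    then have "\<not> tord (x j) (x k)" using m(2)[of "x j"] that xm k(1) by (auto simp: K_def mk)
    then show ?thesis using tord_total[OF xm[OF k(1)] xm[OF that(1)]] by blast
  qed
  define f :: ipoly where "f = Poly_Mapping.single (x k) e"
  have f: "f \<in> I" "f \<noteq> 0" "lt tord f = x k"
    using vars[OF k(1)] e xm[OF k(1)] lookup_single_eq[of "x k" e]
    unfolding f_def by (auto simp: x_def lt_single dest: arg_cong[of _ 0 "\<lambda>f. Poly_Mapping.lookup f (x k)"])
  then obtain g where g: "g \<in> G" "LM tord g dvd LM tord f"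
    using G unfolding min_strong_GB_def by blast
  then have gI: "g \<in> I" "g \<noteq> 0" using G by (auto simp: min_strong_GB_def)
  note gP = subsetD[OF I(2) gI(1)]
  obtain t where "x k = lt tord g + t"
    using g(2) LM_dvd_LM_iff[OF subsetD[OF I(2) f(1)] f(2)] f(3) by auto
  moreover have "lt tord g \<noteq> 0" using lc_neq_0[OF gP gI(2)] no_const[OF gI(1)] by (auto simp: lc_def)
  ultimately have ltg: "lt tord g = x k" using var_eq_addD[of k "lt tord g" t] by (auto simp: x_def)
  \<comment> \<open>Either the weight of \<open>x j\<close> is divisible by \<open>p\<close>, or
    \<open>x j\<close> lies strictly above the leading monomial \<open>x k\<close> and cannot occur
    in \<open>g\<close>. Modulo \<open>p\<close> the relation thus reduces to its term at
    \<open>k\<close>, which is \<open>w k\<close> times the leading coefficient.\<close>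
  have "p dvd w j * Poly_Mapping.lookup g (x j)" if j: "j < l" "j \<noteq> k" for j
  proof (cases "p dvd w j")
    case False
    have "x j \<notin> Poly_Mapping.keys g"
    proof
      assume "x j \<in> Poly_Mapping.keys g"
      then have "tord (x j) (x k)" using tord_lt[OF gP gI(2)] ltg by simp
      then have "x j = x k" using min[OF j(1) False] tord_antisym xm j(1) k(1) by blast
      then show False using j(2) single_var_eq_iff by (simp add: x_def)
    qed
    then show ?thesis by (simp add: in_keys_iff)
  qed simp
  then have "p dvd (\<Sum>j\<in>{..<l} - {k}. w j * Poly_Mapping.lookup g (x j))" by (intro dvd_sum) auto
  moreover have "p dvd w k * Poly_Mapping.lookup g (x k) + (\<Sum>j\<in>{..<l} - {k}. w j * Poly_Mapping.lookup g (x j))"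
    using rel[OF gI(1)] k(1) by (simp add: sum.remove[of "{..<l}" k] x_def)
  ultimately have "p dvd w k * Poly_Mapping.lookup g (x k)" by (simp add: dvd_add_left_iff)
  then have "p dvd lc tord g" using p k(2) by (simp add: lc_def ltg prime_dvd_mult_iff)
  then show ?thesis using G g(1) by (auto simp: lucky_def)
qed

end

section \<open>Smith normal form\<close>

lemma invertible_matI:
  assumes "U \<in> carrier_mat n n" "U' \<in> carrier_mat n n" "U * U' = 1\<^sub>m n" "U' * U = 1\<^sub>m n"
  shows "invertible_mat U"
  using assms unfolding invertible_mat_def inverts_mat_def by auto

lemma invertible_matE:
  assumes "invertible_mat U" "U \<in> carrier_mat n n"
  obtains U' where "U' \<in> carrier_mat n n" "U * U' = 1\<^sub>m n" "U' * U = 1\<^sub>m n"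
proof -
  obtain U' where U': "U * U' = 1\<^sub>m (dim_row U)" "U' * U = 1\<^sub>m (dim_row U')"
    using assms unfolding invertible_mat_def inverts_mat_def by blast
  have "dim_col U' = n" "dim_row U' = n"
    using U' assms(2) by (metis carrier_matD index_mult_mat(3) index_one_mat(3))+
  then show ?thesis using that[of U'] U' assms(2) by auto
qed

lemma invertible_mat_times:
  assumes "invertible_mat U" "U \<in> carrier_mat n n" "invertible_mat V" "V \<in> carrier_mat n n"
  shows "invertible_mat (U * V)"
proof -
  obtain U' where U': "U' \<in> carrier_mat n n" "U * U' = 1\<^sub>m n" "U' * U = 1\<^sub>m n"
    using assms invertible_matE by blast
  obtain V' where V': "V' \<in> carrier_mat n n" "V * V' = 1\<^sub>m n" "V' * V = 1\<^sub>m n"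
    using assms invertible_matE by blast
  have "(U * V) * (V' * U') = U * (V * V') * U'" "(V' * U') * (U * V) = V' * (U' * U) * V"
    using assms U'(1) V'(1) by (simp_all add: assoc_mult_mat[of _ n n _ n _ n])
  then show ?thesis
    using assms U' V' by (intro invertible_matI[of _ n "V' * U'"]) auto
qed

definition mat_equivalent :: "nat \<Rightarrow> nat \<Rightarrow> int mat \<Rightarrow> int mat \<Rightarrow> bool" where
  "mat_equivalent m n A B \<longleftrightarrow> (\<exists>U V. U \<in> carrier_mat m m \<and> V \<in> carrier_mat n n \<and>
     invertible_mat U \<and> invertible_mat V \<and> B = U * A * V)"

lemma invertible_one_mat: "invertible_mat (1\<^sub>m n)"
  by (rule invertible_matI[of _ n "1\<^sub>m n"]) auto

lemma mat_equivalent_refl: "A \<in> carrier_mat m n \<Longrightarrow> mat_equivalent m n A A"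
  unfolding mat_equivalent_def
  by (intro exI[of _ "1\<^sub>m m"] exI[of _ "1\<^sub>m n"]) (auto simp: invertible_one_mat)

lemma mat_equivalent_carrier: "A \<in> carrier_mat m n \<Longrightarrow> mat_equivalent m n A B \<Longrightarrow> B \<in> carrier_mat m n"
  by (auto simp: mat_equivalent_def)

lemma mat_equivalent_trans:
  assumes A: "A \<in> carrier_mat m n" and "mat_equivalent m n A B" "mat_equivalent m n B C"
  shows "mat_equivalent m n A C"
proof -
  obtain U V where UV: "U \<in> carrier_mat m m" "V \<in> carrier_mat n n"
     "invertible_mat U" "invertible_mat V" "B = U * A * V"
    using assms unfolding mat_equivalent_def by blast
  obtain X Y where XY: "X \<in> carrier_mat m m" "Y \<in> carrier_mat n n"
     "invertible_mat X" "invertible_mat Y" "C = X * B * Y"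
    using assms unfolding mat_equivalent_def by blast
  have AV: "A * V \<in> carrier_mat m n"
    using A UV by auto
  have "C = X * (U * (A * V)) * Y"
    using UV XY A by (simp add: assoc_mult_mat[of U m m A n V n])
  also have "\<dots> = (X * U) * (A * V) * Y"
    by (simp only: assoc_mult_mat[OF XY(1) UV(1) AV])
  also have "\<dots> = (X * U) * (A * V * Y)"
    using XY UV by (intro assoc_mult_mat[OF _ AV XY(2)]) auto
  also have "\<dots> = (X * U) * (A * (V * Y))"
    by (simp only: assoc_mult_mat[OF A UV(2) XY(2)])
  also have "\<dots> = (X * U) * A * (V * Y)"
    using XY UV A by (intro assoc_mult_mat[symmetric]) auto
  finally show ?thesis
    unfolding mat_equivalent_def using UV XY
    by (intro exI[of _ "X * U"] exI[of _ "V * Y"]) (auto intro: invertible_mat_times)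
qed

lemma mat_equivalent_left:
  assumes "A \<in> carrier_mat m n" "U \<in> carrier_mat m m" "invertible_mat U"
  shows "mat_equivalent m n A (U * A)"
  unfolding mat_equivalent_def
  by (rule exI[of _ U], rule exI[of _ "1\<^sub>m n"])
    (use assms in \<open>auto simp: invertible_one_mat right_mult_one_mat[of _ m n]\<close>)

lemma mat_equivalent_right:
  assumes "A \<in> carrier_mat m n" "V \<in> carrier_mat n n" "invertible_mat V"
  shows "mat_equivalent m n A (A * V)"
  unfolding mat_equivalent_def
  by (rule exI[of _ "1\<^sub>m m"], rule exI[of _ V])
    (use assms in \<open>auto simp: invertible_one_mat left_mult_one_mat[of _ m n]\<close>)

lemma invertible_addrow_mat:
  "k < n \<Longrightarrow> l < n \<Longrightarrow> k \<noteq> l \<Longrightarrow> invertible_mat (addrow_mat n (a :: int) k l)"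
  using addrow_mat_inv[of k n l a] addrow_mat_inv[of k n l "- a"]
  by (intro invertible_matI[of _ n "addrow_mat n (- a) k l"]) auto

lemma invertible_swaprows_mat: "k < n \<Longrightarrow> l < n \<Longrightarrow> invertible_mat (swaprows_mat n k l :: int mat)"
  using swaprows_mat_inv[of k n l, where 'a = int]
  by (intro invertible_matI[of _ n "swaprows_mat n k l"]) auto

lemma mat_equivalent_elementary:
  assumes A: "A \<in> carrier_mat m n"
  shows mat_equivalent_addrow: "k < m \<Longrightarrow> l < m \<Longrightarrow> k \<noteq> l \<Longrightarrow> mat_equivalent m n A (addrow a k l A)"
    and mat_equivalent_addcol: "k < n \<Longrightarrow> l < n \<Longrightarrow> k \<noteq> l \<Longrightarrow> mat_equivalent m n A (addcol a k l A)"
    and mat_equivalent_swaprows: "k < m \<Longrightarrow> l < m \<Longrightarrow> mat_equivalent m n A (swaprows k l A)"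
    and mat_equivalent_swapcols: "k < n \<Longrightarrow> l < n \<Longrightarrow> mat_equivalent m n A (swapcols k l A)"
proof -
  show "k < m \<Longrightarrow> l < m \<Longrightarrow> k \<noteq> l \<Longrightarrow> mat_equivalent m n A (addrow a k l A)"
    using mat_equivalent_left[OF A _ invertible_addrow_mat] by (simp add: addrow_mat[OF A])
  show "k < n \<Longrightarrow> l < n \<Longrightarrow> k \<noteq> l \<Longrightarrow> mat_equivalent m n A (addcol a k l A)"
    using mat_equivalent_right[OF A _ invertible_addrow_mat[of l n k a]] by (simp add: addcol_mat[OF A])
  show "k < m \<Longrightarrow> l < m \<Longrightarrow> mat_equivalent m n A (swaprows k l A)"
    using mat_equivalent_left[OF A _ invertible_swaprows_mat] by (simp add: swaprows_mat[OF A])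
  show "k < n \<Longrightarrow> l < n \<Longrightarrow> mat_equivalent m n A (swapcols k l A)"
    using mat_equivalent_right[OF A _ invertible_swaprows_mat] by (simp add: swapcols_mat[OF A])
qed

text \<open>The pivot is a nonzero entry of least absolute value among all entries of all matrices
  equivalent to \<open>A\<close>. Any remainder modulo it that appears in an equivalent matrix is
  smaller, hence zero, so no explicit Euclidean loop has to be traced.\<close>

lemma smith_pivot:
  fixes A :: "int mat"
  assumes A: "A \<in> carrier_mat (Suc m) (Suc n)" and nz: "A \<noteq> 0\<^sub>m (Suc m) (Suc n)"
  obtains a C where "a \<noteq> 0" "mat_equivalent (Suc m) (Suc n) A C" "C $$ (0, 0) = a"
    "\<And>i. 0 < i \<Longrightarrow> i < Suc m \<Longrightarrow> C $$ (i, 0) = 0" "\<And>j. 0 < j \<Longrightarrow> j < Suc n \<Longrightarrow> C $$ (0, j) = 0"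
    "\<And>i j. i < Suc m \<Longrightarrow> j < Suc n \<Longrightarrow> a dvd C $$ (i, j)"
proof -
  let ?M = "Suc m" and ?N = "Suc n"
  let ?eq = "mat_equivalent ?M ?N A"
  have carr: "B \<in> carrier_mat ?M ?N" if "?eq B" for B
    using mat_equivalent_carrier[OF A that] .
  have trans: "?eq C" if "?eq B" "mat_equivalent ?M ?N B C" for B C
    using mat_equivalent_trans[OF A that] .
  define S where "S = {nat \<bar>B $$ (i, j)\<bar> | B i j. ?eq B \<and> i < ?M \<and> j < ?N \<and> B $$ (i, j) \<noteq> 0}"
  obtain i0 j0 where "i0 < ?M" "j0 < ?N" "A $$ (i0, j0) \<noteq> 0"
    using nz A by (metis carrier_matD eq_matI index_zero_mat)
  then have "nat \<bar>A $$ (i0, j0)\<bar> \<in> S"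
    using mat_equivalent_refl[OF A] by (auto simp: S_def)
  then have "(LEAST s. s \<in> S) \<in> S" by (rule LeastI)
  then obtain B i j where B: "?eq B" "i < ?M" "j < ?N" "B $$ (i, j) \<noteq> 0"
      and least: "(LEAST s. s \<in> S) = nat \<bar>B $$ (i, j)\<bar>"
    unfolding S_def by blast
  define a where "a = B $$ (i, j)"
  have a: "a \<noteq> 0" using B by (simp add: a_def)
  have min: "C $$ (i, j) = 0" if "?eq C" "i < ?M" "j < ?N" "\<bar>C $$ (i, j)\<bar> < \<bar>a\<bar>" for C i j
  proof (rule ccontr)
    assume "C $$ (i, j) \<noteq> 0"
    then have "nat \<bar>C $$ (i, j)\<bar> \<in> S" using that by (auto simp: S_def)
    then have "nat \<bar>a\<bar> \<le> nat \<bar>C $$ (i, j)\<bar>" using Least_le[of "\<lambda>s. s \<in> S"] by (simp add: least a_def)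
    then show False using that(4) by simp
  qed
  have mod_small: "\<bar>x mod a\<bar> < \<bar>a\<bar>" for x :: int
    using abs_mod_less[OF a] .
  \<comment> \<open>Subtracting the quotient multiple of row 0 leaves the remainder mod
    \<open>a\<close> in position \<open>(i, 0)\<close>, and \<open>min\<close> makes this remainder
    vanish.\<close>
  have dvd_col: "a dvd C $$ (i, 0)" if C: "?eq C" "C $$ (0, 0) = a" "i < ?M" for C i
  proof (cases "i = 0")
    case False
    define D where "D = addrow (- (C $$ (i, 0) div a)) i 0 C"
    have "?eq D" unfolding D_def
      using trans[OF C(1) mat_equivalent_addrow[OF carr[OF C(1)]]] C False by simp
    moreover have "D $$ (i, 0) = C $$ (i, 0) mod a"
      using carr[OF C(1)] C by (simp add: D_def minus_div_mult_eq_mod[symmetric])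
    ultimately have "C $$ (i, 0) mod a = 0"
      using min[of D i 0] C(3) mod_small[of "C $$ (i, 0)"] by simp
    then show ?thesis by (simp add: dvd_eq_mod_eq_0)
  qed (use C in simp)
  have dvd_row: "a dvd C $$ (0, j)" if C: "?eq C" "C $$ (0, 0) = a" "j < ?N" for C j
  proof (cases "j = 0")
    case False
    define D where "D = addcol (- (C $$ (0, j) div a)) j 0 C"
    have "?eq D" unfolding D_def
      using trans[OF C(1) mat_equivalent_addcol[OF carr[OF C(1)]]] C False by simp
    moreover have "D $$ (0, j) = C $$ (0, j) mod a"
      using carr[OF C(1)] C by (simp add: D_def minus_div_mult_eq_mod[symmetric])
    ultimately have "C $$ (0, j) mod a = 0"
      using min[of D 0 j] C(3) mod_small[of "C $$ (0, j)"] by simp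
    then show ?thesis by (simp add: dvd_eq_mod_eq_0)
  qed (use C in simp)
  \<comment> \<open>Two swaps carry the minimal entry into the corner.\<close>
  define B' where "B' = swaprows 0 i (swapcols 0 j B)"
  have sc: "?eq (swapcols 0 j B)"
    using trans[OF B(1) mat_equivalent_swapcols[OF carr[OF B(1)]]] B by simp
  have B': "?eq B'" unfolding B'_def
    using trans[OF sc mat_equivalent_swaprows[OF carr[OF sc]]] B by simp
  have B'00: "B' $$ (0, 0) = a"
    unfolding B'_def a_def using carr[OF B(1)] B by auto
  have cols: "\<exists>C. ?eq C \<and> C $$ (0, 0) = a \<and> (\<forall>i. 0 < i \<longrightarrow> i < k \<longrightarrow> C $$ (i, 0) = 0)" if "k \<le> ?M" for k
    using that
  proof (induction k)
    case 0
    then show ?case using B' B'00 by auto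
  next
    case (Suc k)
    then obtain C where C: "?eq C" "C $$ (0, 0) = a" "\<forall>i. 0 < i \<longrightarrow> i < k \<longrightarrow> C $$ (i, 0) = 0" by auto
    show ?case
    \<comment> \<open>Row 0 carries the pivot itself, so the first step has nothing to
      clear.\<close>
    proof (cases "k = 0")
      case True
      then show ?thesis using C by auto
    next
      case False
      define D where "D = addrow (- (C $$ (k, 0) div a)) k 0 C"
      have "?eq D" unfolding D_def
        using trans[OF C(1) mat_equivalent_addrow[OF carr[OF C(1)]]] Suc.prems False by simp
      moreover have "D $$ (0, 0) = a" "\<forall>i. 0 < i \<longrightarrow> i < Suc k \<longrightarrow> D $$ (i, 0) = 0"
        using carr[OF C(1)] C(2,3) False Suc.prems dvd_col[OF C(1,2), of k]
        by (auto simp: D_def elim!: less_SucE)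
      ultimately show ?thesis by blast
    qed
  qed
  have rows: "\<exists>C. ?eq C \<and> C $$ (0, 0) = a \<and> (\<forall>i. 0 < i \<longrightarrow> i < ?M \<longrightarrow> C $$ (i, 0) = 0) \<and>
     (\<forall>j. 0 < j \<longrightarrow> j < k \<longrightarrow> C $$ (0, j) = 0)" if "k \<le> ?N" for k
    using that
  proof (induction k)
    case 0
    then show ?case using cols[of ?M] by auto
  next
    case (Suc k)
    then obtain C where C: "?eq C" "C $$ (0, 0) = a" "\<forall>i. 0 < i \<longrightarrow> i < ?M \<longrightarrow> C $$ (i, 0) = 0"
        "\<forall>j. 0 < j \<longrightarrow> j < k \<longrightarrow> C $$ (0, j) = 0" by auto
    show ?case
    proof (cases "k = 0")
      case True
      then show ?thesis using C by auto
    next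
      case False
      define D where "D = addcol (- (C $$ (0, k) div a)) k 0 C"
      have "?eq D" unfolding D_def
        using trans[OF C(1) mat_equivalent_addcol[OF carr[OF C(1)]]] Suc.prems False by simp
      moreover have "D $$ (0, 0) = a" "\<forall>j. 0 < j \<longrightarrow> j < Suc k \<longrightarrow> D $$ (0, j) = 0"
        using carr[OF C(1)] C(2,4) False Suc.prems dvd_row[OF C(1,2), of k]
        by (auto simp: D_def elim!: less_SucE)
      moreover have "\<forall>i. 0 < i \<longrightarrow> i < ?M \<longrightarrow> D $$ (i, 0) = 0"
        using carr[OF C(1)] C(3) False by (auto simp: D_def)
      ultimately show ?thesis by blast
    qed
  qed
  obtain C where C: "?eq C" "C $$ (0, 0) = a" "\<forall>i. 0 < i \<longrightarrow> i < ?M \<longrightarrow> C $$ (i, 0) = 0"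
     "\<forall>j. 0 < j \<longrightarrow> j < ?N \<longrightarrow> C $$ (0, j) = 0"
    using rows[of ?N] by auto
  have "a dvd C $$ (i, j)" if ij: "i < ?M" "j < ?N" for i j
  proof (cases "i = 0 \<or> j = 0")
    case True
    then show ?thesis using dvd_col[OF C(1,2)] dvd_row[OF C(1,2)] ij by auto
  next
    case False
    \<comment> \<open>Adding row \<open>i\<close> to row 0 leaves the corner unchanged, as column 0
      is already cleared, and copies the entry \<open>(i, j)\<close> into row 0, where
      \<open>dvd_row\<close> applies.\<close>
    define D where "D = addrow 1 0 i C"
    have "?eq D" unfolding D_def
      using trans[OF C(1) mat_equivalent_addrow[OF carr[OF C(1)]]] ij False by simp
    moreover have "D $$ (0, 0) = a" "D $$ (0, j) = C $$ (i, j)"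
      using carr[OF C(1)] C ij False by (auto simp: D_def)
    ultimately show ?thesis using dvd_row[of D j] ij by simp
  qed
  then show ?thesis using that[OF a C(1,2)] C by blast
qed

text \<open>This keeps the divisibility chain intact in the recursion: a pivot dividing a whole
  block divides the normal form of that block.\<close>

lemma dvd_mult_mat_entries:
  fixes d :: int
  assumes "U \<in> carrier_mat m m" "M \<in> carrier_mat m n" "V \<in> carrier_mat n n"
    and "\<And>i j. i < m \<Longrightarrow> j < n \<Longrightarrow> d dvd M $$ (i, j)" and "i < m" "j < n"
  shows "d dvd (U * M * V) $$ (i, j)"
proof -
  have "d dvd (U * M) $$ (i, k)" if "k < n" for k
    using assms that by (auto simp: scalar_prod_def intro!: dvd_sum)
  then show ?thesis using assms by (subst index_mult_mat(1)) (auto simp: scalar_prod_def intro!: dvd_sum)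
qed

text \<open>Induction on the number of rows: after \<open>smith_pivot\<close> the matrix is block
  diagonal, and the transformations of the smaller block are bordered by a 1 by 1 block.\<close>

lemma smith_normal_form_exists:
  fixes A :: "int mat"
  assumes "A \<in> carrier_mat m n"
  shows "\<exists>D r. mat_equivalent m n A D \<and> smith_diag D r"
  using assms
proof (induction m arbitrary: n A)
  case 0
  then show ?case
    by (intro exI[of _ A] exI[of _ 0]) (auto simp: mat_equivalent_refl smith_diag_def)
next
  case (Suc m N)
  show ?case
  proof (cases "N = 0 \<or> A = 0\<^sub>m (Suc m) N")
    case True
    then show ?thesis using Suc.prems
      by (intro exI[of _ A] exI[of _ 0]) (auto simp: mat_equivalent_refl smith_diag_def)
  next
    case False
    then obtain n where N: "N = Suc n" by (cases N) auto
    obtain a C where a: "a \<noteq> 0" and eqC: "mat_equivalent (Suc m) (Suc n) A C" and C: "C $$ (0, 0) = a"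
      "\<And>i. 0 < i \<Longrightarrow> i < Suc m \<Longrightarrow> C $$ (i, 0) = 0" "\<And>j. 0 < j \<Longrightarrow> j < Suc n \<Longrightarrow> C $$ (0, j) = 0"
      "\<And>i j. i < Suc m \<Longrightarrow> j < Suc n \<Longrightarrow> a dvd C $$ (i, j)"
      using smith_pivot[of A m n] Suc.prems False N by blast
    have Cc: "C \<in> carrier_mat (Suc m) (Suc n)"
      using mat_equivalent_carrier Suc.prems eqC N by blast
    define M where "M = mat m n (\<lambda>(i, j). C $$ (Suc i, Suc j))"
    have Mc: "M \<in> carrier_mat m n" by (simp add: M_def)
    obtain D r where D: "mat_equivalent m n M D" "smith_diag D r" using Suc.IH[OF Mc] by blast
    then obtain U V where UV: "U \<in> carrier_mat m m" "V \<in> carrier_mat n n"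
       "invertible_mat U" "invertible_mat V" "D = U * M * V"
      unfolding mat_equivalent_def by blast
    have Dc: "D \<in> carrier_mat m n" using UV Mc by auto
    have Ddvd: "a dvd D $$ (i, j)" if "i < m" "j < n" for i j
      unfolding UV(5) by (rule dvd_mult_mat_entries[OF UV(1) Mc UV(2)]) (use that C(4) in \<open>auto simp: M_def\<close>)
    obtain U' where U': "U' \<in> carrier_mat m m" "U * U' = 1\<^sub>m m" "U' * U = 1\<^sub>m m"
      using UV invertible_matE by blast
    obtain V' where V': "V' \<in> carrier_mat n n" "V * V' = 1\<^sub>m n" "V' * V = 1\<^sub>m n"
      using UV invertible_matE by blast
    define s where "s x = mat 1 1 (\<lambda>_. x :: int)" for x
    have s: "s x \<in> carrier_mat 1 1" "s x * s y = s (x * y)" "s 1 = 1\<^sub>m 1" for x y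
      by (auto simp: s_def scalar_prod_def)
    define blk where "blk x X = four_block_mat (s x) (0\<^sub>m 1 (dim_col X)) (0\<^sub>m (dim_row X) 1) X" for x X
    have blk_c: "blk x X \<in> carrier_mat (Suc i) (Suc j)" if "X \<in> carrier_mat i j" for x X i j
      using that four_block_carrier_mat[OF s(1) that, of x] by (simp add: blk_def)
    have blk_mult: "blk x X * blk y Y = blk (x * y) (X * Y)"
      if "X \<in> carrier_mat i j" "Y \<in> carrier_mat j k" for x y X Y i j k
      unfolding blk_def
      by (subst mult_four_block_mat[of _ 1 1 _ j _ i _ _ 1 _ k])
        (use that in \<open>auto simp: s right_mult_zero_mat[OF s(1)] left_mult_zero_mat[OF s(1)] simp del: One_nat_def\<close>)
    have blk_one: "blk 1 (1\<^sub>m i) = 1\<^sub>m (Suc i)" for i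
      using four_block_one_mat[of 1 i] by (simp add: blk_def s(3)[simplified])
    have C_blk: "C = blk a M"
    proof (rule eq_matI)
      fix i j assume "i < dim_row (blk a M)" "j < dim_col (blk a M)"
      then have "i < Suc m" "j < Suc n" using blk_c[OF Mc, of a] by auto
      then show "C $$ (i, j) = blk a M $$ (i, j)"
        using C Mc by (cases i; cases j) (auto simp: blk_def s_def M_def)
    qed (use Cc blk_c[OF Mc, of a] in auto)
    \<comment> \<open>The corner of the left transformation is the sign of \<open>a\<close>, which
      turns the pivot into the positive entry demanded by \<open>smith_diag\<close>.\<close>
    have sg: "sgn a * sgn a = 1" using a by (simp add: sgn_if)
    have inv: "invertible_mat (blk (sgn a) U)" "invertible_mat (blk 1 V)"
    proof -
      show "invertible_mat (blk (sgn a) U)"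
        by (rule invertible_matI[of _ "Suc m" "blk (sgn a) U'"])
          (use UV U' a in \<open>auto simp: blk_c blk_mult[of _ m m _ m] sg blk_one\<close>)
      show "invertible_mat (blk 1 V)"
        by (rule invertible_matI[of _ "Suc n" "blk 1 V'"])
          (use UV V' in \<open>auto simp: blk_c blk_mult[of _ n n _ n] blk_one\<close>)
    qed
    have "blk (sgn a) U * C * blk 1 V = blk \<bar>a\<bar> D"
      unfolding C_blk blk_mult[OF UV(1) Mc] UV(5)
      by (subst blk_mult[of _ m n _ n]) (use UV Mc in \<open>auto simp: abs_sgn mult.commute\<close>)
    then have "mat_equivalent (Suc m) (Suc n) C (blk \<bar>a\<bar> D)"
      unfolding mat_equivalent_def using inv blk_c[OF UV(1)] blk_c[OF UV(2)] by metis
    then have "mat_equivalent (Suc m) N A (blk \<bar>a\<bar> D)"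
      using mat_equivalent_trans Suc.prems eqC N by blast
    moreover have "smith_diag (blk \<bar>a\<bar> D) (Suc r)"
    proof -
      have dims: "dim_row (blk \<bar>a\<bar> D) = Suc m" "dim_col (blk \<bar>a\<bar> D) = Suc n"
        using blk_c[OF Dc, of "\<bar>a\<bar>"] by auto
      have ent: "blk \<bar>a\<bar> D $$ (i, j) =
          (case i of 0 \<Rightarrow> (case j of 0 \<Rightarrow> \<bar>a\<bar> | Suc _ \<Rightarrow> 0)
             | Suc i' \<Rightarrow> (case j of 0 \<Rightarrow> 0 | Suc j' \<Rightarrow> D $$ (i', j')))" if "i < Suc m" "j < Suc n" for i j
        using that Dc by (auto simp: blk_def s_def split: nat.split)
      have r: "r \<le> m" "r \<le> n" using D(2) Dc by (auto simp: smith_diag_def)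
      show ?thesis unfolding smith_diag_def dims
      proof (intro conjI allI impI)
        show "Suc r \<le> min (Suc m) (Suc n)" using r by simp
        fix i
        show "i < Suc m \<Longrightarrow> j < Suc n \<Longrightarrow> i \<noteq> j \<Longrightarrow> blk \<bar>a\<bar> D $$ (i, j) = 0" for j
          using D(2) Dc by (auto simp: ent smith_diag_def split: nat.split)
        show "blk \<bar>a\<bar> D $$ (i, i) > 0" if "i < Suc r"
          using D(2) r a that by (auto simp: ent smith_diag_def split: nat.split)
        show "blk \<bar>a\<bar> D $$ (i, i) = 0" if "Suc r \<le> i \<and> i < min (Suc m) (Suc n)"
          using D(2) Dc that by (auto simp: ent smith_diag_def split: nat.split)
        show "blk \<bar>a\<bar> D $$ (i, i) dvd blk \<bar>a\<bar> D $$ (i + 1, i + 1)" if "i + 1 < Suc r"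
          using D(2) r Ddvd that by (auto simp: ent smith_diag_def split: nat.split)
      qed
    qed
    ultimately show ?thesis by blast
  qed
qed

text \<open>Entrywise form of a Smith decomposition of rank \<open>r\<close> with diagonal
  \<open>d\<close>: with \<open>U'\<close>, \<open>V'\<close> the inverses of \<open>U\<close>,
  \<open>V\<close>, the equation \<open>U A V = D\<close> is split into \<open>A V = U' D\<close>
  and \<open>U A = D V'\<close>.\<close>

locale smith_transform =
  fixes l s r :: nat and A U U' V V' :: "nat \<Rightarrow> nat \<Rightarrow> int" and d :: "nat \<Rightarrow> int"
  assumes r: "0 < r" "r \<le> l" "r \<le> s"
    and d_pos: "i < r \<Longrightarrow> d i > 0"
    and d_dvd: "i < r \<Longrightarrow> d i dvd d (r - 1)"
    and AV: "k < l \<Longrightarrow> j < s \<Longrightarrow> (\<Sum>t<s. A k t * V t j) = (if j < r then U' k j * d j else 0)"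
    and UA: "i < l \<Longrightarrow> t < s \<Longrightarrow> (\<Sum>k<l. U i k * A k t) = (if i < r then d i * V' i t else 0)"
    and UU': "i < l \<Longrightarrow> j < l \<Longrightarrow> (\<Sum>k<l. U i k * U' k j) = (if i = j then 1 else 0)"
    and U'U: "i < l \<Longrightarrow> j < l \<Longrightarrow> (\<Sum>k<l. U' i k * U k j) = (if i = j then 1 else 0)"
    and VV': "i < s \<Longrightarrow> j < s \<Longrightarrow> (\<Sum>k<s. V i k * V' k j) = (if i = j then 1 else 0)"
    and V'V: "i < s \<Longrightarrow> j < s \<Longrightarrow> (\<Sum>k<s. V' i k * V k j) = (if i = j then 1 else 0)"
begin

text \<open>If \<open>r < l\<close>, row \<open>r\<close> of \<open>U\<close> annihilates every
  column of \<open>A\<close>, yet it is nonzero because \<open>U\<close> is invertible.\<close>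

lemma rank_eq_rows:
  assumes "\<And>x :: nat \<Rightarrow> int. \<forall>t<s. (\<Sum>k<l. x k * A k t) = 0 \<Longrightarrow> \<forall>k<l. x k = 0"
  shows "r = l"
proof (rule ccontr)
  assume "r \<noteq> l"
  then have "r < l" using r by simp
  then have "\<forall>k<l. U r k = 0" by (intro assms) (simp add: UA)
  then show False using UU'[of r r] \<open>r < l\<close> by simp
qed

lemma last_multiple_in_span:
  assumes "r = l" "k < l"
  shows "\<exists>z. \<forall>k'<l. (\<Sum>t<s. A k' t * z t) = (if k = k' then d (r - 1) else 0)"
proof (intro exI allI impI)
  fix k' assume k': "k' < l"
  let ?e = "d (r - 1)"
  \<comment> \<open>The witness \<open>z\<close> is \<open>V\<close> applied to column
    \<open>k\<close> of \<open>U\<close> after scaling its entry \<open>j\<close> by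
    \<open>d (r - 1)\<close> divided by \<open>d j\<close>. Applying \<open>A\<close> replaces
    \<open>V\<close> by \<open>U' D\<close>, the scaling equalizes the diagonal, and
    \<open>U' U\<close> is the identity.\<close>
  have "(\<Sum>t<s. A k' t * (\<Sum>j<l. V t j * (?e div d j * U j k)))
    = (\<Sum>j<l. (\<Sum>t<s. A k' t * V t j) * (?e div d j * U j k))"
    by (simp add: sum_distrib_left sum_distrib_right mult.assoc sum.swap[of _ "{..<s}"])
  also have "\<dots> = (\<Sum>j<l. ?e * (U' k' j * U j k))"
  proof (rule sum.cong)
    fix j assume "j \<in> {..<l}"
    then have j: "j < r" "j < s" using assms r by auto
    then have "d j * (?e div d j) = ?e" using d_dvd by simp
    then show "(\<Sum>t<s. A k' t * V t j) * (?e div d j * U j k) = ?e * (U' k' j * U j k)"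
      using AV[OF k' j(2)] j(1) by (simp add: ac_simps)
  qed simp
  also have "\<dots> = (if k = k' then ?e else 0)"
    using U'U[OF k' assms(2)] by (simp flip: sum_distrib_left)
  finally show "(\<Sum>t<s. A k' t * (\<Sum>j<l. V t j * (?e div d j * U j k))) = (if k = k' then ?e else 0)" .
qed

text \<open>Row \<open>r - 1\<close> of \<open>U\<close> serves: its product with \<open>A\<close>
  is \<open>d (r - 1)\<close> times a row of \<open>V'\<close>, while its product with a column of
  \<open>U'\<close> is 1, so \<open>p\<close> cannot divide all of its entries.\<close>

lemma row_relation:
  fixes p :: int
  assumes "\<not> p dvd 1" "p dvd d (r - 1)"
  shows "\<exists>w. (\<exists>k<l. \<not> p dvd w k) \<and> (\<forall>t<s. p dvd (\<Sum>k<l. w k * A k t))"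
proof (rule exI[of _ "U (r - 1)"], intro conjI allI impI)
  have r1: "r - 1 < l" "r - 1 < r" using r by auto
  show "\<exists>k<l. \<not> p dvd U (r - 1) k"
  proof (rule ccontr)
    assume "\<not> ?thesis"
    then have "p dvd (\<Sum>k<l. U (r - 1) k * U' k (r - 1))" by (intro dvd_sum) auto
    then show False using UU'[OF r1(1) r1(1)] assms by simp
  qed
  show "p dvd (\<Sum>k<l. U (r - 1) k * A k t)" if "t < s" for t
    using UA[OF r1(1) that] r1 assms by simp
qed

text \<open>Here \<open>u\<close> is column \<open>r - 1\<close> of \<open>U'\<close> and
  \<open>y\<close> the same column of \<open>V\<close>. Applying row \<open>r - 1\<close> of
  \<open>U\<close> to a relation \<open>N u = A z\<close> gives \<open>N\<close> on the left and a
  multiple of \<open>d (r - 1)\<close> on the right.\<close>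

lemma last_torsion:
  "\<exists>y u. (\<forall>k<l. (\<Sum>t<s. A k t * y t) = d (r - 1) * u k) \<and>
     (\<forall>N z. (\<forall>k<l. N * u k = (\<Sum>t<s. A k t * z t)) \<longrightarrow> d (r - 1) dvd N)"
proof (intro exI conjI allI impI)
  have r1: "r - 1 < l" "r - 1 < r" "r - 1 < s" using r by auto
  show "(\<Sum>t<s. A k t * V t (r - 1)) = d (r - 1) * U' k (r - 1)" if "k < l" for k
    using AV[OF that r1(3)] r1(2) by simp
  fix N z assume N: "\<forall>k<l. N * U' k (r - 1) = (\<Sum>t<s. A k t * z t)"
  have "N = N * (\<Sum>k<l. U (r - 1) k * U' k (r - 1))" using UU'[OF r1(1) r1(1)] by simp
  also have "\<dots> = (\<Sum>k<l. U (r - 1) k * (N * U' k (r - 1)))"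
    by (simp add: sum_distrib_left ac_simps)
  also have "\<dots> = (\<Sum>k<l. U (r - 1) k * (\<Sum>t<s. A k t * z t))" using N by simp
  also have "\<dots> = (\<Sum>t<s. (\<Sum>k<l. U (r - 1) k * A k t) * z t)"
    by (simp add: sum_distrib_left sum_distrib_right mult.assoc sum.swap[of _ "{..<l}"])
  also have "\<dots> = (\<Sum>t<s. d (r - 1) * (V' (r - 1) t * z t))"
    by (rule sum.cong) (use UA[OF r1(1)] r1(2) in \<open>auto simp: mult.assoc\<close>)
  finally show "d (r - 1) dvd N" by (metis dvd_triv_left sum_distrib_left)
qed

text \<open>If \<open>p\<close> does not divide the last diagonal entry, it divides none of them,
  and independence of the columns gives \<open>r = s\<close>. Then \<open>p\<close> dividing
  \<open>U A y = D V' y\<close> implies that it divides \<open>V' y\<close>, hence also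
  \<open>y = V V' y\<close>.\<close>

lemma prime_dvd_last:
  fixes p :: int
  assumes p: "prime p"
    and indep: "\<And>y. \<forall>k<l. (\<Sum>t<s. A k t * y t) = 0 \<Longrightarrow> \<forall>t<s. y t = 0"
    and y: "\<forall>k<l. p dvd (\<Sum>t<s. A k t * y t)" "t0 < s" "\<not> p dvd y t0"
  shows "p dvd d (r - 1)"
proof (rule ccontr)
  assume nd: "\<not> ?thesis"
  have "r = s"
  proof (rule ccontr)
    assume "r \<noteq> s"
    then have rs: "r < s" using r by simp
    then have "\<forall>t<s. V t r = 0" by (intro indep) (simp add: AV)
    then show False using V'V[OF rs rs] by simp
  qed
  have *: "p dvd (\<Sum>t<s. V' i t * y t)" if i: "i < s" for i
  proof -
    have il: "i < l" "i < r" using i r \<open>r = s\<close> by auto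
    have "p dvd (\<Sum>k<l. U i k * (\<Sum>t<s. A k t * y t))" using y(1) by (intro dvd_sum) auto
    also have "\<dots> = (\<Sum>t<s. (\<Sum>k<l. U i k * A k t) * y t)"
      by (simp add: sum_distrib_left sum_distrib_right mult.assoc sum.swap[of _ "{..<l}"])
    also have "\<dots> = (\<Sum>t<s. d i * (V' i t * y t))"
      by (rule sum.cong) (use UA[OF il(1)] il(2) in \<open>auto simp: mult.assoc\<close>)
    also have "\<dots> = d i * (\<Sum>t<s. V' i t * y t)" by (simp add: sum_distrib_left)
    finally show ?thesis
      using p nd d_dvd[OF il(2)] by (metis dvd_trans prime_dvd_multD)
  qed
  have "y t0 = (\<Sum>t<s. (\<Sum>i<s. V t0 i * V' i t) * y t)"
    using y(2) by (simp add: VV' if_distrib[of "\<lambda>x. x * _"] cong: if_cong)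
  also have "\<dots> = (\<Sum>i<s. V t0 i * (\<Sum>t<s. V' i t * y t))"
    by (simp add: sum_distrib_left sum_distrib_right mult.assoc sum.swap[of "\<lambda>t i. V t0 i * (V' i t * y t)"])
  also have "p dvd \<dots>" using * by (intro dvd_sum) auto
  finally show False using y(3) by simp
qed

end

lemma smith_transform_of_smith_normal_form:
  assumes A: "A \<in> carrier_mat l s" and U: "U \<in> carrier_mat l l" "invertible_mat U"
    and V: "V \<in> carrier_mat s s" "invertible_mat V"
    and D: "U * A * V = D" "smith_diag D r" "0 < r"
  shows "\<exists>U' V'. smith_transform l s r (\<lambda>i j. A $$ (i, j)) (\<lambda>i j. U $$ (i, j)) U'
    (\<lambda>i j. V $$ (i, j)) V' (\<lambda>i. D $$ (i, i))"
proof -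
  obtain U' where U': "U' \<in> carrier_mat l l" "U * U' = 1\<^sub>m l" "U' * U = 1\<^sub>m l"
    using U invertible_matE by blast
  obtain V' where V': "V' \<in> carrier_mat s s" "V * V' = 1\<^sub>m s" "V' * V = 1\<^sub>m s"
    using V invertible_matE by blast
  have Dc: "D \<in> carrier_mat l s" using A U V D by auto
  have entry: "(X * Y) $$ (i, j) = (\<Sum>k<b. X $$ (i, k) * Y $$ (k, j))"
    if "X \<in> carrier_mat a b" "Y \<in> carrier_mat b d" "i < a" "j < d"
    for X Y :: "int mat" and a b d i j
    using that by (simp add: scalar_prod_def atLeast0LessThan)
  have AV: "A * V = U' * D"
  proof -
    have "U' * D = U' * (U * (A * V))"
      using A U V D(1) assoc_mult_mat[OF U(1) A V(1)] by simp
    also have "\<dots> = (U' * U) * (A * V)"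
      using A U V U' by (intro assoc_mult_mat[symmetric]) auto
    finally show ?thesis using A V U' by simp
  qed
  have UA: "U * A = D * V'"
  proof -
    have "D * V' = (U * A) * (V * V')"
      unfolding D(1)[symmetric] using A U V V' by (intro assoc_mult_mat) auto
    then show ?thesis using A U V' by simp
  qed
  have off: "D $$ (i, j) = 0" if "i < l" "j < s" "i \<noteq> j" for i j
    using D(2) Dc that by (auto simp: smith_diag_def)
  have diag0: "D $$ (i, i) = 0" if "i < l" "i < s" "\<not> i < r" for i
    using D(2) Dc that by (auto simp: smith_diag_def)
  have r: "r \<le> l" "r \<le> s" using D(2) Dc by (auto simp: smith_diag_def)
  have "smith_transform l s r (\<lambda>i j. A $$ (i, j)) (\<lambda>i j. U $$ (i, j)) (\<lambda>i j. U' $$ (i, j))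
    (\<lambda>i j. V $$ (i, j)) (\<lambda>i j. V' $$ (i, j)) (\<lambda>i. D $$ (i, i))"
  proof
    show "0 < r" "r \<le> l" "r \<le> s" using D r by auto
    show "D $$ (i, i) > 0" if "i < r" for i using D(2) that by (auto simp: smith_diag_def)
    show "D $$ (i, i) dvd D $$ (r - 1, r - 1)" if "i < r" for i
    proof -
      have "D $$ (i, i) dvd D $$ (i + j, i + j)" if "i + j < r" for j
        using that
      proof (induction j)
        case (Suc j)
        then have "D $$ (i + j, i + j) dvd D $$ (i + j + 1, i + j + 1)"
          using D(2) unfolding smith_diag_def by simp
        then show ?case using Suc dvd_trans by fastforce
      qed simp
      from this[of "r - 1 - i"] show ?thesis using that by simp
    qed
    show "(\<Sum>t<s. A $$ (k, t) * V $$ (t, j)) = (if j < r then U' $$ (k, j) * D $$ (j, j) else 0)"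
      if "k < l" "j < s" for k j
    proof -
      have "(\<Sum>t<s. A $$ (k, t) * V $$ (t, j)) = (\<Sum>i<l. U' $$ (k, i) * D $$ (i, j))"
        using entry[OF A V(1) that] entry[OF U'(1) Dc that] AV by simp
      \<comment> \<open>Only the diagonal term can survive; for \<open>j \<ge> r\<close> it is
        either zero or outside the range of summation.\<close>
      also have "\<dots> = (\<Sum>i<l. if i = j then (if j < r then U' $$ (k, j) * D $$ (j, j) else 0) else 0)"
        by (rule sum.cong) (use that off diag0 in auto)
      also have "\<dots> = (if j < r then U' $$ (k, j) * D $$ (j, j) else 0)"
        using r by auto
      finally show ?thesis .
    qed
    show "(\<Sum>k<l. U $$ (i, k) * A $$ (k, t)) = (if i < r then D $$ (i, i) * V' $$ (i, t) else 0)"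
      if "i < l" "t < s" for i t
    proof -
      have "(\<Sum>k<l. U $$ (i, k) * A $$ (k, t)) = (\<Sum>j<s. D $$ (i, j) * V' $$ (j, t))"
        using entry[OF U(1) A that] entry[OF Dc V'(1) that] UA by simp
      also have "\<dots> = (\<Sum>j<s. if j = i then (if i < r then D $$ (i, i) * V' $$ (i, t) else 0) else 0)"
        by (rule sum.cong) (use that off diag0 in auto)
      also have "\<dots> = (if i < r then D $$ (i, i) * V' $$ (i, t) else 0)"
        using r by auto
      finally show ?thesis .
    qed
    show "(\<Sum>k<l. U $$ (i, k) * U' $$ (k, j)) = (if i = j then 1 else 0)"
      and "(\<Sum>k<l. U' $$ (i, k) * U $$ (k, j)) = (if i = j then 1 else 0)" if "i < l" "j < l" for i j
      using entry[OF U(1) U'(1) that] entry[OF U'(1) U(1) that] U' that by simp_all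
    show "(\<Sum>k<s. V $$ (i, k) * V' $$ (k, j)) = (if i = j then 1 else 0)"
      and "(\<Sum>k<s. V' $$ (i, k) * V $$ (k, j)) = (if i = j then 1 else 0)" if "i < s" "j < s" for i j
      using entry[OF V(1) V'(1) that] entry[OF V'(1) V(1) that] V' that by simp_all
  qed
  then show ?thesis by blast
qed

text \<open>A normal form of positive rank exists, so the choice in \<open>e_last\<close> is
  realized by actual matrices. What follows is derived for whichever normal form was chosen.\<close>

lemma e_last_smith_transform:
  assumes J: "finite J" and nz: "i \<in> J" "k < l" "c k i \<noteq> 0"
  obtains r U U' V V' d where
    "smith_transform l (card J) r (\<lambda>k t. c k (sorted_list_of_set J ! t)) U U' V V' d"
    "e_last l c J = d (r - 1)"
proof -
  let ?s = "card J" and ?A = "sub_mat l c J"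
  have A: "?A \<in> carrier_mat l ?s" by (simp add: sub_mat_def)
  obtain D r U V where U: "U \<in> carrier_mat l l" "invertible_mat U"
    and V: "V \<in> carrier_mat ?s ?s" "invertible_mat V" and D: "U * ?A * V = D" "smith_diag D r"
    using smith_normal_form_exists[OF A] unfolding mat_equivalent_def by metis
  \<comment> \<open>Rank zero would make \<open>D\<close> zero, and undoing \<open>U\<close> and
    \<open>V\<close> would make the matrix of columns zero, contrary to the nonzero entry
    \<open>c k i\<close>.\<close>
  have "0 < r"
  proof (rule ccontr)
    assume "\<not> 0 < r"
    have Dc: "D \<in> carrier_mat l ?s" using A U V D by auto
    have "D $$ (i, j) = 0" if "i < l" "j < ?s" for i j
      using D(2) Dc that \<open>\<not> 0 < r\<close> by (cases "i = j") (auto simp: smith_diag_def)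
    then have D0: "D = 0\<^sub>m l ?s" using Dc by (intro eq_matI) auto
    obtain U' where U': "U' \<in> carrier_mat l l" "U' * U = 1\<^sub>m l"
      using U invertible_matE by blast
    obtain V' where V': "V' \<in> carrier_mat ?s ?s" "V * V' = 1\<^sub>m ?s"
      using V invertible_matE by blast
    have "U * ?A = U * ?A * (V * V')" using U A V' by simp
    also have "\<dots> = D * V'"
      unfolding D(1)[symmetric] using A U V V' by (intro assoc_mult_mat[symmetric]) auto
    finally have UA0: "U * ?A = 0\<^sub>m l ?s" using D0 V' by simp
    have "?A = U' * U * ?A" using U' A by simp
    also have "\<dots> = U' * (U * ?A)" by (rule assoc_mult_mat[OF U'(1) U(1) A])
    finally have A0: "?A = 0\<^sub>m l ?s" using UA0 U' by simp
    obtain t where t: "t < ?s" "sorted_list_of_set J ! t = i"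
      using nz(1) J by (metis in_set_conv_nth length_sorted_list_of_set set_sorted_list_of_set)
    have "c k i = ?A $$ (k, t)" using t nz(2) by (simp add: sub_mat_def)
    then show False using A0 t nz by simp
  qed
  have "\<exists>e. \<exists>U V D r. U \<in> carrier_mat l l \<and> V \<in> carrier_mat ?s ?s \<and>
      invertible_mat U \<and> invertible_mat V \<and>
      U * ?A * V = D \<and> smith_diag D r \<and> 0 < r \<and> e = D $$ (r - 1, r - 1)"
    using U V D \<open>0 < r\<close> by blast
  from someI_ex[OF this] obtain U V D r where U: "U \<in> carrier_mat l l" "invertible_mat U"
    and V: "V \<in> carrier_mat ?s ?s" "invertible_mat V" and D: "U * ?A * V = D" "smith_diag D r" "0 < r"
    and e: "e_last l c J = D $$ (r - 1, r - 1)"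
    unfolding e_last_def by blast
  obtain U' V' where tr: "smith_transform l ?s r (\<lambda>i j. ?A $$ (i, j)) (\<lambda>i j. U $$ (i, j)) U'
      (\<lambda>i j. V $$ (i, j)) V' (\<lambda>i. D $$ (i, i))"
    using smith_transform_of_smith_normal_form[OF A U V D] by blast
  interpret smith_transform l ?s r "\<lambda>i j. ?A $$ (i, j)" "\<lambda>i j. U $$ (i, j)" U'
      "\<lambda>i j. V $$ (i, j)" V' "\<lambda>i. D $$ (i, i)"
    by (rule tr)
  have entry: "?A $$ (k, t) = c k (sorted_list_of_set J ! t)" if "k < l" "t < ?s" for k t
    using that by (simp add: sub_mat_def)
  have "smith_transform l ?s r (\<lambda>k t. c k (sorted_list_of_set J ! t)) (\<lambda>i j. U $$ (i, j)) U'
      (\<lambda>i j. V $$ (i, j)) V' (\<lambda>i. D $$ (i, i))"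
  proof
    show "(\<Sum>t<?s. c k (sorted_list_of_set J ! t) * V $$ (t, j)) = (if j < r then U' k j * D $$ (j, j) else 0)"
      if "k < l" "j < ?s" for k j
      using AV[OF that] that by (simp add: entry)
    show "(\<Sum>k<l. U $$ (i, k) * c k (sorted_list_of_set J ! t)) = (if i < r then D $$ (i, i) * V' i t else 0)"
      if "i < l" "t < ?s" for i t
      using UA[OF that] that by (simp add: entry)
  qed (fact r d_pos d_dvd UU' U'U VV' V'V)+
  then show ?thesis using that e by blast
qed

section \<open>Columns and bases\<close>

text \<open>Fraction-free Gaussian elimination: one equation with a nonzero coefficient is used to
  eliminate one unknown from the others.\<close>

lemma homogeneous_system_nontrivial:
  fixes a :: "'e \<Rightarrow> 'i \<Rightarrow> int"
  assumes "finite E" "finite J" "card E < card J"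
  shows "\<exists>y. (\<exists>i\<in>J. y i \<noteq> 0) \<and> (\<forall>e\<in>E. (\<Sum>i\<in>J. a e i * y i) = 0)"
  using assms
proof (induction E arbitrary: J a rule: finite_induct)
  case empty
  then have "J \<noteq> {}" by auto
  then show ?case by (intro exI[of _ "\<lambda>_. 1"]) auto
next
  case (insert e0 E)
  show ?case
  proof (cases "\<forall>i\<in>J. a e0 i = 0")
    case True
    moreover obtain y where "\<exists>i\<in>J. y i \<noteq> 0" "\<forall>e\<in>E. (\<Sum>i\<in>J. a e i * y i) = 0"
      using insert.IH[of J a] insert.prems insert.hyps by auto
    ultimately show ?thesis by (intro exI[of _ y]) auto
  next
    case False
    then obtain i0 where i0: "i0 \<in> J" "a e0 i0 \<noteq> 0" by blast
    define J' where "J' = J - {i0}"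
    have J': "finite J'" "card E < card J'"
      using insert.prems insert.hyps i0 by (auto simp: J'_def)
    obtain y where y: "\<exists>i\<in>J'. y i \<noteq> 0"
        "\<forall>e\<in>E. (\<Sum>i\<in>J'. (a e0 i0 * a e i - a e i0 * a e0 i) * y i) = 0"
      using insert.IH[OF J', of "\<lambda>e i. a e0 i0 * a e i - a e i0 * a e0 i"] by blast
    \<comment> \<open>Back substitution: the smaller solution is scaled by the pivot
      \<open>a e0 i0\<close>, which keeps the eliminated coordinate integral.\<close>
    define y' where "y' i = (if i = i0 then - (\<Sum>j\<in>J'. a e0 j * y j) else a e0 i0 * y i)" for i
    have "(\<Sum>i\<in>J. a e i * y' i) = (\<Sum>i\<in>J'. (a e0 i0 * a e i - a e i0 * a e0 i) * y i)" for e
    proof -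
      have "(\<Sum>i\<in>J. a e i * y' i) = a e i0 * y' i0 + (\<Sum>i\<in>J'. a e i * y' i)"
        unfolding J'_def using insert.prems i0 by (intro sum.remove) auto
      also have "(\<Sum>i\<in>J'. a e i * y' i) = (\<Sum>i\<in>J'. a e0 i0 * a e i * y i)"
        by (rule sum.cong) (auto simp: y'_def J'_def)
      finally show ?thesis
        by (simp add: y'_def left_diff_distrib sum_subtractf sum_distrib_left mult.assoc)
    qed
    \<comment> \<open>For \<open>e0\<close> itself the eliminated coefficients cancel identically;
      for the other equations the choice of \<open>y\<close> applies.\<close>
    then have "\<forall>e\<in>insert e0 E. (\<Sum>i\<in>J. a e i * y' i) = 0" using y(2) by (auto simp: mult.commute)
    moreover have "\<exists>i\<in>J. y' i \<noteq> 0"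
      using y(1) i0 by (auto simp: y'_def J'_def)
    ultimately show ?thesis by blast
  qed
qed

context
  fixes l :: nat and c :: "nat \<Rightarrow> nat \<Rightarrow> int"
begin

text \<open>Clearing denominators shows that testing integer coefficients amounts to linear
  independence over the rationals.\<close>

definition indep_columns :: "nat set \<Rightarrow> bool" where
  "indep_columns J \<longleftrightarrow> (\<forall>y :: nat \<Rightarrow> int. (\<forall>k<l. (\<Sum>i\<in>J. c k i * y i) = 0) \<longrightarrow> (\<forall>i\<in>J. y i = 0))"

text \<open>Membership in the rational span, with \<open>a\<close> as a common denominator.\<close>

definition in_span :: "nat set \<Rightarrow> (nat \<Rightarrow> int) \<Rightarrow> bool" where
  "in_span J v \<longleftrightarrow> (\<exists>a z. a \<noteq> 0 \<and> (\<forall>k<l. a * v k = (\<Sum>j\<in>J. c k j * z j)))"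

lemma indep_columnsD:
  "indep_columns J \<Longrightarrow> (\<And>k. k < l \<Longrightarrow> (\<Sum>i\<in>J. c k i * y i) = 0) \<Longrightarrow> i \<in> J \<Longrightarrow> y i = 0"
  unfolding indep_columns_def by blast

lemma indep_columns_card:
  assumes "finite J" "indep_columns J"
  shows "card J \<le> l"
proof (rule ccontr)
  assume "\<not> card J \<le> l"
  then obtain y where "\<exists>i\<in>J. y i \<noteq> 0" "\<forall>k\<in>{..<l}. (\<Sum>i\<in>J. c k i * y i) = 0"
    using homogeneous_system_nontrivial[of "{..<l}" J c] assms by auto
  then show False using assms(2) unfolding indep_columns_def by (metis lessThan_iff)
qed

lemma in_span_sum:
  assumes "\<And>i. i \<in> M \<Longrightarrow> in_span J (v i)"
  shows "in_span J (\<lambda>k. \<Sum>i\<in>M. v i k * y i)"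
  using assms
proof (induction M rule: infinite_finite_induct)
  case (insert i M)
  obtain a z where a: "a \<noteq> 0" "\<And>k. k < l \<Longrightarrow> a * v i k = (\<Sum>j\<in>J. c k j * z j)"
    using insert.prems unfolding in_span_def by blast
  obtain b x where b: "b \<noteq> 0" "\<And>k. k < l \<Longrightarrow> b * (\<Sum>i\<in>M. v i k * y i) = (\<Sum>j\<in>J. c k j * x j)"
    using insert.IH insert.prems unfolding in_span_def by blast
  have "a * b * (\<Sum>i\<in>insert i M. v i k * y i) = (\<Sum>j\<in>J. c k j * (b * y i * z j + a * x j))"
    if "k < l" for k
  proof -
    have "a * b * (\<Sum>i\<in>insert i M. v i k * y i)
      = b * y i * (a * v i k) + a * (b * (\<Sum>i\<in>M. v i k * y i))"
      using insert.hyps by (simp add: algebra_simps)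
    also have "\<dots> = (\<Sum>j\<in>J. c k j * (b * y i * z j + a * x j))"
      unfolding a(2)[OF that] b(2)[OF that]
      by (simp add: sum_distrib_left sum.distrib distrib_left ac_simps)
    finally show ?thesis .
  qed
  then show ?case unfolding in_span_def using a(1) b(1)
    by (intro exI[of _ "a * b"] exI[of _ "\<lambda>j. b * y i * z j + a * x j"]) auto
qed (auto simp: in_span_def intro!: exI[of _ 1] exI[of _ "\<lambda>_. 0"])

lemma in_span_column:
  assumes "finite J" "j \<in> J"
  shows "in_span J (\<lambda>k. c k j)"
  unfolding in_span_def
  using assms by (intro exI[of _ 1] exI[of _ "\<lambda>i. if i = j then 1 else 0"])
    (auto simp: if_distrib[of "\<lambda>x. _ * x"] cong: if_cong)

lemma in_span_of_dependent:
  assumes J: "finite J" "indep_columns J" and i: "i \<notin> J" and dep: "\<not> indep_columns (insert i J)"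
  shows "in_span J (\<lambda>k. c k i)"
proof -
  obtain y i' where y: "\<And>k. k < l \<Longrightarrow> (\<Sum>j\<in>insert i J. c k j * y j) = 0" "i' \<in> insert i J" "y i' \<noteq> 0"
    using dep unfolding indep_columns_def by blast
  have eq: "c k i * y i + (\<Sum>j\<in>J. c k j * y j) = 0" if "k < l" for k
    using y(1)[OF that] J(1) i by simp
  have "y i \<noteq> 0"
  proof
    assume "y i = 0"
    then have "\<forall>j\<in>J. y j = 0" using eq indep_columnsD[OF J(2), of y] by simp
    then show False using y \<open>y i = 0\<close> by auto
  qed
  moreover have "y i * c k i = (\<Sum>j\<in>J. c k j * - y j)" if "k < l" for k
    using eq[OF that] by (simp add: sum_negf mult.commute)
  ultimately show ?thesis
    unfolding in_span_def by (intro exI[of _ "y i"] exI[of _ "\<lambda>j. - y j"]) simp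
qed

text \<open>A maximal independent set between \<open>J\<close> and \<open>M\<close> spans every
  column of \<open>M\<close>, since adjoining a further column creates a dependence.\<close>

lemma extend_to_basis:
  assumes M: "finite M" "J \<subseteq> M" and J: "indep_columns J"
  obtains B where "J \<subseteq> B" "B \<subseteq> M" "indep_columns B" "\<And>i. i \<in> M \<Longrightarrow> in_span B (\<lambda>k. c k i)"
proof -
  define F where "F = {B. J \<subseteq> B \<and> B \<subseteq> M \<and> indep_columns B}"
  have "finite F" "F \<noteq> {}"
    using M J by (auto simp: F_def intro: finite_subset[of _ "Pow M"])
  then obtain B where "B \<in> F" and max: "\<And>B'. B' \<in> F \<Longrightarrow> B \<subseteq> B' \<Longrightarrow> B = B'"
    using finite_has_maximal[of F] by metis
  then have B: "J \<subseteq> B" "B \<subseteq> M" "indep_columns B" by (auto simp: F_def)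
  have fin: "finite B" using B M finite_subset by blast
  have "in_span B (\<lambda>k. c k i)" if "i \<in> M" for i
  proof (cases "i \<in> B")
    case False
    then have "\<not> indep_columns (insert i B)" using max[of "insert i B"] B that by (auto simp: F_def)
    then show ?thesis using in_span_of_dependent[OF fin B(3) False] by blast
  qed (rule in_span_column[OF fin])
  then show ?thesis using that B by blast
qed

text \<open>Up to a nonzero factor the forms in \<open>M\<close> are combinations of those in
  \<open>B\<close>, so a common zero of \<open>B\<close> is a common zero of
  \<open>M\<close>.\<close>

lemma meet_zero_of_span:
  assumes M: "meet_zero l c M" and span: "\<And>i. i \<in> M \<Longrightarrow> in_span B (\<lambda>k. c k i)"
  shows "meet_zero l c B"
  unfolding meet_zero_def
proof (rule allI, rule impI)
  fix x :: "nat \<Rightarrow> rat"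
  assume x: "\<forall>j\<in>B. (\<Sum>k<l. of_int (c k j) * x k) = 0"
  have "(\<Sum>k<l. of_int (c k i) * x k) = 0" if i: "i \<in> M" for i
  proof -
    obtain a z where a: "a \<noteq> 0" "\<And>k. k < l \<Longrightarrow> a * c k i = (\<Sum>j\<in>B. c k j * z j)"
      using span[OF i] unfolding in_span_def by blast
    have "of_int a * (\<Sum>k<l. of_int (c k i) * x k) = (\<Sum>k<l. of_int (a * c k i) * x k)"
      by (simp add: sum_distrib_left mult.assoc)
    also have "\<dots> = (\<Sum>k<l. of_int (\<Sum>j\<in>B. c k j * z j) * x k)"
      using a(2) by simp
    also have "\<dots> = (\<Sum>j\<in>B. of_int (z j) * (\<Sum>k<l. of_int (c k j) * x k))"
      by (simp add: sum_distrib_left sum_distrib_right ac_simps sum.swap[of _ "{..<l}"])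
    also have "\<dots> = 0" using x by simp
    finally show ?thesis using a(1) by simp
  qed
  then show "\<forall>k<l. x k = 0" using M unfolding meet_zero_def by blast
qed

lemma meet_zeroD_int:
  fixes x :: "nat \<Rightarrow> int"
  assumes "meet_zero l c J" "\<And>i. i \<in> J \<Longrightarrow> (\<Sum>k<l. x k * c k i) = 0" "k < l"
  shows "x k = 0"
proof -
  have "(\<Sum>k<l. of_int (c k i) * (of_int (x k) :: rat)) = 0" if "i \<in> J" for i
    using arg_cong[OF assms(2)[OF that], of "of_int :: int \<Rightarrow> rat"] by (simp add: mult.commute)
  then have "(of_int (x k) :: rat) = 0"
    using assms(1,3) unfolding meet_zero_def by (auto dest: spec[of _ "\<lambda>k. of_int (x k)"])
  then show ?thesis by simp
qed

lemma meet_zero_card: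
  assumes "finite J" "meet_zero l c J"
  shows "l \<le> card J"
proof (rule ccontr)
  assume "\<not> l \<le> card J"
  then obtain x where "\<exists>k\<in>{..<l}. x k \<noteq> 0" "\<forall>i\<in>J. (\<Sum>k\<in>{..<l}. c k i * x k) = 0"
    using homogeneous_system_nontrivial[of J "{..<l}" "\<lambda>i k. c k i"] assms by auto
  then show False using meet_zeroD_int[OF assms(2), of x] by (auto simp: mult.commute)
qed

text \<open>The facts on matrices are carried from column positions to column indices along the
  sorted enumeration of \<open>J\<close>. Coefficient vectors indexed by positions are pulled back
  through its inverse.\<close>

lemma e_last_facts:
  assumes J: "finite J" and nz: "i0 \<in> J" "k0 < l" "c k0 i0 \<noteq> 0"
  shows e_last_pos: "e_last l c J > 0"
    and e_last_multiple_in_span: "meet_zero l c J \<Longrightarrow> k < l \<Longrightarrow>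
      \<exists>z. \<forall>k'<l. (\<Sum>i\<in>J. c k' i * z i) = (if k = k' then e_last l c J else 0)"
    and e_last_row_relation: "\<not> p dvd 1 \<Longrightarrow> p dvd e_last l c J \<Longrightarrow>
      \<exists>w. (\<exists>k<l. \<not> p dvd w k) \<and> (\<forall>i\<in>J. p dvd (\<Sum>k<l. w k * c k i))"
    and e_last_torsion: "\<exists>y u. (\<forall>k<l. (\<Sum>i\<in>J. c k i * y i) = e_last l c J * u k) \<and>
      (\<forall>N z. (\<forall>k<l. N * u k = (\<Sum>i\<in>J. c k i * z i)) \<longrightarrow> e_last l c J dvd N)"
    and prime_dvd_e_last: "prime p \<Longrightarrow> indep_columns J \<Longrightarrow> \<forall>k<l. p dvd (\<Sum>i\<in>J. c k i * y i) \<Longrightarrow>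
      i \<in> J \<Longrightarrow> \<not> p dvd y i \<Longrightarrow> p dvd e_last l c J"
proof -
  let ?\<sigma> = "\<lambda>t. sorted_list_of_set J ! t" and ?s = "card J"
  obtain r U U' V V' d where tr: "smith_transform l ?s r (\<lambda>k t. c k (?\<sigma> t)) U U' V V' d"
    and e: "e_last l c J = d (r - 1)"
    using e_last_smith_transform[where c = c, OF J nz] .
  interpret smith_transform l ?s r "\<lambda>k t. c k (?\<sigma> t)" U U' V V' d by (rule tr)
  have bij: "bij_betw ?\<sigma> {..<?s} J"
    using bij_betw_nth[OF distinct_sorted_list_of_set, of "{..<?s}" J J] J by simp
  have inv: "inv_into {..<?s} ?\<sigma> (?\<sigma> t) = t" if "t < ?s" for t
    using bij that by (simp add: bij_betw_def inv_into_f_f)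
  have sumJ: "(\<Sum>i\<in>J. f i) = (\<Sum>t<?s. f (?\<sigma> t))" for f :: "nat \<Rightarrow> int"
    by (rule sum.reindex_bij_betw[OF bij, symmetric])
  have sum_inv: "(\<Sum>i\<in>J. c k i * z (inv_into {..<?s} ?\<sigma> i)) = (\<Sum>t<?s. c k (?\<sigma> t) * z t)"
    for k and z :: "nat \<Rightarrow> int"
    unfolding sumJ by (rule sum.cong) (auto simp: inv)
  have \<sigma>J: "?\<sigma> t \<in> J" if "t < ?s" for t
    using bij that by (auto simp: bij_betw_def)
  have J\<sigma>: "\<exists>t<?s. ?\<sigma> t = i" if "i \<in> J" for i
    using bij that by (force simp: bij_betw_def)
  show "e_last l c J > 0" unfolding e using r by (intro d_pos) auto
  show "\<exists>z. \<forall>k'<l. (\<Sum>i\<in>J. c k' i * z i) = (if k = k' then e_last l c J else 0)"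
    if "meet_zero l c J" "k < l"
  proof -
    have "r = l"
    proof (rule rank_eq_rows, intro allI impI)
      fix x :: "nat \<Rightarrow> int" and k
      assume x: "\<forall>t<?s. (\<Sum>k<l. x k * c k (?\<sigma> t)) = 0" and "k < l"
      show "x k = 0"
        by (rule meet_zeroD_int[OF that(1) _ \<open>k < l\<close>]) (use x J\<sigma> in blast)
    qed
    then obtain z where "\<forall>k'<l. (\<Sum>t<?s. c k' (?\<sigma> t) * z t) = (if k = k' then d (r - 1) else 0)"
      using last_multiple_in_span \<open>k < l\<close> by blast
    then show ?thesis
      by (intro exI[of _ "\<lambda>i. z (inv_into {..<?s} ?\<sigma> i)"]) (simp add: sum_inv e)
  qed
  show "\<exists>w. (\<exists>k<l. \<not> p dvd w k) \<and> (\<forall>i\<in>J. p dvd (\<Sum>k<l. w k * c k i))"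
    if "\<not> p dvd 1" "p dvd e_last l c J"
    using row_relation[OF that[unfolded e]] J\<sigma> by metis
  obtain y0 u0 where yu: "\<forall>k<l. (\<Sum>t<?s. c k (?\<sigma> t) * y0 t) = d (r - 1) * u0 k"
     "\<forall>N z. (\<forall>k<l. N * u0 k = (\<Sum>t<?s. c k (?\<sigma> t) * z t)) \<longrightarrow> d (r - 1) dvd N"
    using last_torsion by blast
  show "\<exists>y u. (\<forall>k<l. (\<Sum>i\<in>J. c k i * y i) = e_last l c J * u k) \<and>
      (\<forall>N z. (\<forall>k<l. N * u k = (\<Sum>i\<in>J. c k i * z i)) \<longrightarrow> e_last l c J dvd N)"
  proof (rule exI[of _ "\<lambda>i. y0 (inv_into {..<?s} ?\<sigma> i)"], rule exI[of _ u0], intro conjI allI impI)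
    show "(\<Sum>i\<in>J. c k i * y0 (inv_into {..<?s} ?\<sigma> i)) = e_last l c J * u0 k" if "k < l" for k
      using yu(1) that by (simp add: sum_inv e)
    show "e_last l c J dvd N" if "\<forall>k<l. N * u0 k = (\<Sum>i\<in>J. c k i * z i)" for N z
      using yu(2)[rule_format, of N "\<lambda>t. z (?\<sigma> t)"] that by (simp add: e sumJ)
  qed
  show "p dvd e_last l c J"
    if p: "prime p" and ind: "indep_columns J" and y: "\<forall>k<l. p dvd (\<Sum>i\<in>J. c k i * y i)" "i \<in> J" "\<not> p dvd y i"
  proof -
    obtain t0 where t0: "t0 < ?s" "?\<sigma> t0 = i" using J\<sigma> y(2) by blast
    show ?thesis unfolding e
    proof (rule prime_dvd_last[OF p _ _ t0(1), of "\<lambda>t. y (?\<sigma> t)"])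
      fix x :: "nat \<Rightarrow> int" assume x: "\<forall>k<l. (\<Sum>t<?s. c k (?\<sigma> t) * x t) = 0"
      have "x (inv_into {..<?s} ?\<sigma> (?\<sigma> t)) = 0" if "t < ?s" for t
        by (rule indep_columnsD[OF ind, of "\<lambda>i. x (inv_into {..<?s} ?\<sigma> i)"])
          (use x that \<sigma>J in \<open>auto simp: sum_inv\<close>)
      then show "\<forall>t<?s. x t = 0" by (simp add: inv)
    qed (use y t0 in \<open>auto simp: sumJ\<close>)
  qed
qed

text \<open>The vector \<open>u\<close> has order \<open>e_last l c J\<close> modulo the lattice spanned by \<open>J\<close>; since
  it lies in the rational span of \<open>J\<close>, its order cannot drop when \<open>J\<close> is enlarged to a basis.\<close>
lemma e_last_dvd_e_last_basis:
  assumes ess: "meet_zero l c {..<n}" and J: "J \<subseteq> {..<n}" "i0 \<in> J"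
    and nz: "\<And>i. i < n \<Longrightarrow> \<exists>k<l. c k i \<noteq> 0"
  obtains B where "B \<subseteq> {..<n}" "card B = l" "meet_zero l c B" "e_last l c J dvd e_last l c B"
proof -
  have finJ: "finite J" using J finite_subset by blast
  \<comment> \<open>First a basis \<open>J'\<close> of the span of \<open>J\<close>, then its
    extension to a basis \<open>B\<close> of the whole space; \<open>B\<close> need not contain
    \<open>J\<close>.\<close>
  obtain J' where J': "J' \<subseteq> J" "indep_columns J'" "\<And>i. i \<in> J \<Longrightarrow> in_span J' (\<lambda>k. c k i)"
    using extend_to_basis[OF finJ, of "{}"] by (auto simp: indep_columns_def)
  obtain B where B: "J' \<subseteq> B" "B \<subseteq> {..<n}" "indep_columns B" "\<And>i. i \<in> {..<n} \<Longrightarrow> in_span B (\<lambda>k. c k i)"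
    using extend_to_basis[of "{..<n}" J'] J J' by blast
  have finB: "finite B" using B finite_subset by blast
  have mz: "meet_zero l c B" using meet_zero_of_span[OF ess B(4)] .
  have card: "card B = l"
    using indep_columns_card[OF finB B(3)] meet_zero_card[OF finB mz] by simp
  obtain k0 where k0: "k0 < l" "c k0 i0 \<noteq> 0" using nz[of i0] J by auto
  then have "B \<noteq> {}" using card by auto
  then obtain i1 where i1: "i1 \<in> B" by blast
  then obtain k1 where k1: "k1 < l" "c k1 i1 \<noteq> 0" using nz[of i1] B by auto
  let ?e = "e_last l c J" and ?f = "e_last l c B"
  obtain y u where u: "\<And>k. k < l \<Longrightarrow> (\<Sum>i\<in>J. c k i * y i) = ?e * u k"
    and tor: "\<And>N z. (\<And>k. k < l \<Longrightarrow> N * u k = (\<Sum>i\<in>J. c k i * z i)) \<Longrightarrow> ?e dvd N"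
    using e_last_torsion[OF finJ J(2) k0] by blast
  have "\<forall>k. \<exists>z. k < l \<longrightarrow> (\<forall>k'<l. (\<Sum>i\<in>B. c k' i * z i) = (if k = k' then ?f else 0))"
    using e_last_multiple_in_span[OF finB i1 k1 mz] by blast
  then obtain z where z: "\<And>k k'. k < l \<Longrightarrow> k' < l \<Longrightarrow>
      (\<Sum>i\<in>B. c k' i * z k i) = (if k = k' then ?f else 0)"
    by metis
  \<comment> \<open>These are the integer coordinates of \<open>?f * u\<close> with respect to
    \<open>B\<close>, obtained by combining the representations of \<open>?f\<close> times the unit
    vectors.\<close>
  define b where "b i = (\<Sum>k<l. u k * z k i)" for i
  have b: "?f * u k' = (\<Sum>i\<in>B. c k' i * b i)" if k': "k' < l" for k'
  proof -
    have "(\<Sum>i\<in>B. c k' i * b i) = (\<Sum>k<l. u k * (\<Sum>i\<in>B. c k' i * z k i))"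
      by (simp add: b_def sum_distrib_left ac_simps sum.swap[of _ B])
    also have "\<dots> = (\<Sum>k<l. if k = k' then u k * ?f else 0)"
      by (rule sum.cong) (use z k' in auto)
    also have "\<dots> = ?f * u k'" using k' by (simp add: mult.commute)
    finally show ?thesis by simp
  qed
  have "in_span J' (\<lambda>k. \<Sum>i\<in>J. c k i * y i)" by (rule in_span_sum) (rule J'(3))
  then obtain a x where a: "a \<noteq> 0" "\<And>k. k < l \<Longrightarrow> a * (\<Sum>i\<in>J. c k i * y i) = (\<Sum>j\<in>J'. c k j * x j)"
    unfolding in_span_def by blast
  have sub: "(\<Sum>j\<in>J'. c k j * g j) = (\<Sum>j\<in>A. c k j * (if j \<in> J' then g j else 0))"
    if "J' \<subseteq> A" "finite A" for A k and g :: "nat \<Rightarrow> int"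
    by (rule sum.mono_neutral_cong_left) (use that in auto)
  \<comment> \<open>The vector \<open>a * ?e * ?f * u\<close> has two expansions in
    \<open>B\<close>: one from \<open>b\<close>, one from the rational span of \<open>J'\<close>.
    Independence of \<open>B\<close> equates them, so the coordinates outside \<open>J'\<close>
    vanish.\<close>
  have b0: "b j = 0" if j: "j \<in> B" "j \<notin> J'" for j
  proof -
    have "a * ?e * b j - ?f * (if j \<in> J' then x j else 0) = 0"
    proof (rule indep_columnsD[OF B(3) _ j(1), of "\<lambda>j. a * ?e * b j - ?f * (if j \<in> J' then x j else 0)"])
      fix k assume k: "k < l"
      have "(\<Sum>i\<in>B. c k i * (a * ?e * b i - ?f * (if i \<in> J' then x i else 0)))
        = a * ?e * (\<Sum>i\<in>B. c k i * b i) - ?f * (\<Sum>i\<in>B. c k i * (if i \<in> J' then x i else 0))"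
        unfolding sum_distrib_left sum_subtractf[symmetric] by (rule sum.cong) (auto simp: algebra_simps)
      also have "\<dots> = a * ?e * (?f * u k) - ?f * (a * (?e * u k))"
        unfolding sub[OF B(1) finB, symmetric] a(2)[OF k, symmetric] b[OF k] u[OF k] ..
      finally show "(\<Sum>i\<in>B. c k i * (a * ?e * b i - ?f * (if i \<in> J' then x i else 0))) = 0" by simp
    qed
    then show ?thesis using j(2) a(1) e_last_pos[OF finJ J(2) k0] by simp
  qed
  \<comment> \<open>Now \<open>?f * u\<close> is an integer combination of the columns in
    \<open>J'\<close>, hence of those in \<open>J\<close>, and the order of \<open>u\<close> modulo
    the lattice of \<open>J\<close> divides \<open>?f\<close>.\<close>
  have "?e dvd ?f"
  proof (rule tor)
    fix k assume "k < l"
    then have "?f * u k = (\<Sum>i\<in>B. c k i * b i)" by (rule b)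
    also have "\<dots> = (\<Sum>i\<in>B. c k i * (if i \<in> J' then b i else 0))"
      by (rule sum.cong) (auto simp: b0)
    also have "\<dots> = (\<Sum>i\<in>J. c k i * (if i \<in> J' then b i else 0))"
      using sub[OF B(1) finB] sub[OF J'(1) finJ] by metis
    finally show "?f * u k = (\<Sum>i\<in>J. c k i * (if i \<in> J' then b i else 0))" .
  qed
  then show ?thesis using that B card mz by blast
qed

section \<open>Primes dividing the lcm period\<close>

lemma prime_dvd_rho0_iff:
  fixes p :: int
  assumes p: "prime p" and nz: "\<And>i. i < n \<Longrightarrow> \<exists>k<l. c k i \<noteq> 0"
  shows "p dvd rho0 l n c \<longleftrightarrow> (\<exists>J\<subseteq>{..<n}. J \<noteq> {} \<and> card J \<le> l \<and> p dvd e_last l c J)"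
proof
  define \<J> where "\<J> = {J. J \<subseteq> {..<n} \<and> J \<noteq> {} \<and> card J \<le> l}"
  have "finite \<J>" by (rule finite_subset[of _ "Pow {..<n}"]) (auto simp: \<J>_def)
  assume "p dvd rho0 l n c"
  \<comment> \<open>The lcm divides the product of the finitely many \<open>e_last l c J\<close>, so
    primality isolates a single factor.\<close>
  also have "rho0 l n c dvd (\<Prod>J\<in>\<J>. e_last l c J)"
    unfolding rho0_def \<J>_def[symmetric] using \<open>finite \<J>\<close> by (auto intro!: Lcm_least dvd_prodI)
  finally obtain J where "J \<in> \<J>" "p dvd e_last l c J"
    using p \<open>finite \<J>\<close> by (auto simp: prime_dvd_prod_iff)
  then show "\<exists>J\<subseteq>{..<n}. J \<noteq> {} \<and> card J \<le> l \<and> p dvd e_last l c J" by (auto simp: \<J>_def)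
next
  assume "\<exists>J\<subseteq>{..<n}. J \<noteq> {} \<and> card J \<le> l \<and> p dvd e_last l c J"
  then obtain J where "J \<subseteq> {..<n} \<and> J \<noteq> {} \<and> card J \<le> l" "p dvd e_last l c J" by blast
  then show "p dvd rho0 l n c"
    unfolding rho0_def by (auto intro!: dvd_trans[OF _ dvd_Lcm])
qed

lemma not_good_prime_imp:
  fixes p :: int
  assumes p: "prime p" and nz: "\<And>i. i < n \<Longrightarrow> \<exists>k<l. c k i \<noteq> 0"
    and distinct: "\<forall>i j. i < j \<and> j < n \<longrightarrow> \<not> (\<exists>a::rat. \<forall>k<l. of_int (c k i) = a * of_int (c k j))"
    and bad: "\<not> good_prime l n c p"
  shows "\<exists>J\<subseteq>{..<n}. J \<noteq> {} \<and> card J \<le> l \<and> p dvd e_last l c J"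
proof -
  obtain i j where ij: "i < j" "j < n"
    and "(\<exists>a. \<forall>k<l. [c k i = a * c k j] (mod p)) \<or> (\<exists>a. \<forall>k<l. [c k j = a * c k i] (mod p))"
    using bad unfolding good_prime_def by blast
  then obtain a where "(\<forall>k<l. p dvd c k i - a * c k j) \<or> (\<forall>k<l. p dvd c k j - a * c k i)"
    by (auto simp: cong_iff_dvd_diff)
  \<comment> \<open>Proportionality mod \<open>p\<close> is a relation with coefficients 1 and
    \<open>- a\<close>; the coefficient 1 makes it nontrivial mod \<open>p\<close>.\<close>
  then obtain y where y: "\<forall>k<l. p dvd (\<Sum>i\<in>{i, j}. c k i * y i)" "\<not> p dvd y i \<or> \<not> p dvd y j"
  proof
    assume *: "\<forall>k<l. p dvd c k i - a * c k j"
    show ?thesis by (rule that[of "\<lambda>x. if x = i then 1 else - a"])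
      (use * ij p in \<open>auto simp: mult.commute\<close>)
  next
    assume *: "\<forall>k<l. p dvd c k j - a * c k i"
    show ?thesis by (rule that[of "\<lambda>x. if x = j then 1 else - a"])
      (use * ij p in \<open>auto simp: mult.commute\<close>)
  qed
  have ind: "indep_columns {i, j}"
    unfolding indep_columns_def
  proof (rule allI, rule impI)
    fix x :: "nat \<Rightarrow> int" assume "\<forall>k<l. (\<Sum>i\<in>{i, j}. c k i * x i) = 0"
    then have x: "c k i * x i + c k j * x j = 0" if "k < l" for k using that ij by simp
    have "x i = 0"
    proof (rule ccontr)
      assume xi: "x i \<noteq> 0"
      have "of_int (c k i) = (- of_int (x j) / of_int (x i) :: rat) * of_int (c k j)" if "k < l" for k
        using arg_cong[OF x[OF that], of "of_int :: int \<Rightarrow> rat"] xi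
        by (simp add: field_simps eq_neg_iff_add_eq_0)
      then show False using distinct ij by blast
    qed
    moreover obtain k where "k < l" "c k j \<noteq> 0" using nz[OF ij(2)] by blast
    ultimately have "x j = 0" using x by fastforce
    then show "\<forall>i\<in>{i, j}. x i = 0" using \<open>x i = 0\<close> by simp
  qed
  obtain k where k: "k < l" "c k i \<noteq> 0" using nz[of i] ij by auto
  have "p dvd e_last l c {i, j}"
    using y(2) prime_dvd_e_last[of "{i, j}" i k p y, OF _ _ k p ind y(1)] by auto
  \<comment> \<open>Independence of the two columns forces \<open>l\<close> to be at least 2, so the
    pair is among the sets entering the lcm.\<close>
  then show ?thesis using ij indep_columns_card[OF _ ind] by (intro exI[of _ "{i, j}"]) auto
qed

end

theorem theorem7p6:
  fixes l n :: nat and c :: "nat \<Rightarrow> nat \<Rightarrow> int"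
    and tord :: "monom \<Rightarrow> monom \<Rightarrow> bool" and p :: int
  assumes primitive: "\<forall>i<n. \<forall>q::int. prime q \<longrightarrow> \<not> (\<forall>k<l. q dvd c k i)"
    and distinct: "\<forall>i j. i < j \<and> j < n \<longrightarrow>
                      \<not> (\<exists>a::rat. \<forall>k<l. of_int (c k i) = a * of_int (c k j))"
    and essential: "meet_zero l c {..<n}"
    and order: "term_order l tord"
    and prime: "prime p"
  shows "(\<not> good_prime l n c p \<or> \<not> lucky_arr l n c tord p) \<longleftrightarrow> p dvd rho0 l n c"
proof -
  interpret monomial_order l tord by unfold_locales (rule order)
  have nz: "\<exists>k<l. c k i \<noteq> 0" if "i < n" for i
    using primitive that prime by (metis dvd_0_right)
  have vars: "Poly_Mapping.single (Poly_Mapping.single k 1) (e_last l c J) \<in> gen_ideal l (lin_form l c ` J)"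
    if J: "J \<subseteq> {..<n}" "card J = l" "meet_zero l c J" and k: "k < l" for J k
  proof -
    have fin: "finite J" using J finite_subset by blast
    obtain i where "i \<in> J" using J k by fastforce
    moreover obtain k1 where "k1 < l" "c k1 i \<noteq> 0" using nz[of i] J \<open>i \<in> J\<close> by auto
    ultimately show ?thesis
      using e_last_multiple_in_span[OF fin _ _ _ J(3) k] var_in_gen_lin_forms[OF fin k] by metis
  qed
  show ?thesis
  proof
    assume "\<not> good_prime l n c p \<or> \<not> lucky_arr l n c tord p"
    then have "\<exists>J\<subseteq>{..<n}. J \<noteq> {} \<and> card J \<le> l \<and> p dvd e_last l c J"
    proof
      assume "\<not> lucky_arr l n c tord p"
      then obtain J G g where J: "J \<subseteq> {..<n}" "card J = l" "meet_zero l c J"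
        and G: "min_strong_GB l tord G (gen_ideal l (lin_form l c ` J))" "g \<in> G" "p dvd lc tord g"
        unfolding lucky_arr_def lucky_def by blast
      have "lc tord g dvd e_last l c J"
        by (rule lc_min_strong_GB_dvd[OF is_ideal_gen_ideal gen_lin_forms_in_polys
              lookup_gen_lin_forms_0 vars[OF J] G(1,2)])
      then have "p dvd e_last l c J" using G(3) dvd_trans by blast
      \<comment> \<open>An empty \<open>J\<close> would generate the zero ideal, whose bases have no
        elements, whereas \<open>G\<close> contains \<open>g\<close>.\<close>
      moreover have "J \<noteq> {}"
      proof
        assume "J = {}"
        then have "gen_ideal l (lin_form l c ` J) = {0}" by (auto simp: gen_ideal_def)
        then show False using G(1,2) by (auto simp: min_strong_GB_def)
      qed
      ultimately show ?thesis using J by blast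
    qed (rule not_good_prime_imp[OF prime nz distinct])
    then show "p dvd rho0 l n c" using prime_dvd_rho0_iff[of p n l c, OF prime nz] by blast
  next
    assume "p dvd rho0 l n c"
    then obtain J i where J: "J \<subseteq> {..<n}" "i \<in> J" "p dvd e_last l c J"
      using prime_dvd_rho0_iff[of p n l c, OF prime nz] by blast
    \<comment> \<open>This direction always exhibits a basis at which \<open>p\<close> is unlucky,
      whether or not \<open>p\<close> is good.\<close>
    obtain B where B: "B \<subseteq> {..<n}" "card B = l" "meet_zero l c B" "e_last l c J dvd e_last l c B"
      using e_last_dvd_e_last_basis[OF essential J(1,2) nz] .
    have pB: "p dvd e_last l c B" using J(3) B(4) dvd_trans by blast
    obtain k where "k < l" using nz[of i] J by blast
    then have "l > 0" by simp
    then obtain i1 where i1: "i1 \<in> B" using B(2) by fastforce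
    then obtain k1 where k1: "k1 < l" "c k1 i1 \<noteq> 0" using nz[of i1] B by auto
    have fin: "finite B" using B finite_subset by blast
    obtain w k0 where w: "k0 < l" "\<not> p dvd w k0" "\<forall>i\<in>B. p dvd (\<Sum>k<l. w k * c k i)"
      using e_last_row_relation[OF fin i1 k1 _ pB] not_prime_unit prime by blast
    have "\<not> lucky l tord p (gen_ideal l (lin_form l c ` B))"
    proof (rule not_lucky_if_linear_relation[OF is_ideal_gen_ideal gen_lin_forms_in_polys prime _
          lookup_gen_lin_forms_0 vars[OF B(1-3)] w(1,2) dvd_gen_lin_forms[OF _ w(3)]])
      show "e_last l c B \<noteq> 0" using e_last_pos[where c = c, OF fin i1 k1] by simp
    qed
    then have "\<not> lucky_arr l n c tord p" using B unfolding lucky_arr_def by blast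
    then show "\<not> good_prime l n c p \<or> \<not> lucky_arr l n c tord p" ..
  qed
qed

end
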